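(* Let $\Omega$ be a bounded interval, $\phi\in\mathcal{A}_3$ and $$I(x,t)=\int_{\Omega}e^{i(t\phi(\xi)-x\xi)}|\phi'''(\xi)|^{1/3}\,d\xi.$$ Then for any $x,t\in\mathbb{R}$ with $t\ne0$, $$|I(x,t)|\leq c_\phi|t|^{-1/3},$$ where $c_\phi$ (independent of $x$ and $t$) depends only on the constants involved in the definition of the class $\mathcal{A}_3$.
   Context: For a bounded interval $\Omega\subset\mathbb{R}$, $\mathcal{A}_3$ is the class of real functions $\phi\in C^4(\overline{\Omega})$ satisfying the following conditions: 1) the set $S_\phi=\{\xi\in\Omega:\phi'''(\xi)=0\}$ is finite; 2) if $\xi_0\in S_\phi$ then there exist positive constants $\epsilon,c_1,c_2$ and a constant $\alpha\geq 3$ such that for all $\xi\in\Omega$ with $|\xi-\xi_0|<\epsilon$, $$c_1|\xi-\xi_0|^{\alpha-3}\leq|\phi'''(\xi)|\leq c_2|\xi-\xi_0|^{\alpha-3};$$ 3) $\phi'''$ has a finite number of changes of monotonicity.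
   Formalization: Zeros of φ''' in the closure of Ω are required to lie in Ω (the bound can fail for a zero at a missing endpoint), and the constants that c_φ depends on include the numbers of zeros and monotonicity changes and bounds 0<m≤|φ'''|≤K away from the zeros. *)

theory Defs
  imports "HOL-Analysis.Analysis"
begin

(* Derivatives are taken within X, so on a closed interval they are one-sided at the
   endpoints and do not depend on the values of f outside X. *)
primrec nderiv_within :: "real set \<Rightarrow> nat \<Rightarrow> (real \<Rightarrow> real) \<Rightarrow> real \<Rightarrow> real" where
  "nderiv_within X 0 f = f"
| "nderiv_within X (Suc k) f = (\<lambda>x. vector_derivative (nderiv_within X k f) (at x within X))"

definition Ck_on :: "nat \<Rightarrow> real set \<Rightarrow> (real \<Rightarrow> real) \<Rightarrow> bool" where
  "Ck_on k X f \<longleftrightarrow>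
     (\<forall>j<k. nderiv_within X j f differentiable_on X) \<and> continuous_on X (nderiv_within X k f)"

definition bounded_interval :: "real set \<Rightarrow> bool" where
  "bounded_interval \<Omega> \<longleftrightarrow> is_interval \<Omega> \<and> bounded \<Omega> \<and> interior \<Omega> \<noteq> {}"

abbreviation deriv3 :: "real set \<Rightarrow> (real \<Rightarrow> real) \<Rightarrow> real \<Rightarrow> real" where
  "deriv3 \<Omega> \<phi> \<equiv> nderiv_within (closure \<Omega>) 3 \<phi>"

definition zeros3 :: "real set \<Rightarrow> (real \<Rightarrow> real) \<Rightarrow> real set" where
  "zeros3 \<Omega> \<phi> = {\<xi> \<in> \<Omega>. deriv3 \<Omega> \<phi> \<xi> = 0}"

(* Condition 2) at the zero z, with the quadruple (\<epsilon>, c1, c2, \<alpha>) of its constants.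
   0 powr 0 = 0 only matters at \<xi> = z for \<alpha> = 3, a value excluded by continuity of the
   third derivative under either convention. *)
fun zero_bounds ::
  "real set \<Rightarrow> (real \<Rightarrow> real) \<Rightarrow> real \<Rightarrow> real \<times> real \<times> real \<times> real \<Rightarrow> bool" where
  "zero_bounds \<Omega> \<phi> z (\<epsilon>, c1, c2, \<alpha>) \<longleftrightarrow>
     \<epsilon> > 0 \<and> c1 > 0 \<and> c2 > 0 \<and> \<alpha> \<ge> 3 \<and>
     (\<forall>\<xi>\<in>\<Omega>. \<bar>\<xi> - z\<bar> < \<epsilon> \<longrightarrow>
        c1 * \<bar>\<xi> - z\<bar> powr (\<alpha> - 3) \<le> \<bar>deriv3 \<Omega> \<phi> \<xi>\<bar> \<and>
        \<bar>deriv3 \<Omega> \<phi> \<xi>\<bar> \<le> c2 * \<bar>\<xi> - z\<bar> powr (\<alpha> - 3))"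

(* f changes monotonicity at most at the points of the finite set P. *)
definition monotone_off :: "real set \<Rightarrow> (real \<Rightarrow> real) \<Rightarrow> real set \<Rightarrow> bool" where
  "monotone_off \<Omega> f P \<longleftrightarrow>
     finite P \<and> P \<subseteq> \<Omega> \<and>
     (\<forall>J. is_interval J \<and> J \<subseteq> \<Omega> - P \<longrightarrow> mono_on J f \<or> antimono_on J f)"

definition A3 :: "real set \<Rightarrow> (real \<Rightarrow> real) set" where
  "A3 \<Omega> = {\<phi>. Ck_on 4 (closure \<Omega>) \<phi> \<and>
     finite (zeros3 \<Omega> \<phi>) \<and>
     (\<forall>z\<in>zeros3 \<Omega> \<phi>. \<exists>\<epsilon> c1 c2 \<alpha>. zero_bounds \<Omega> \<phi> z (\<epsilon>, c1, c2, \<alpha>)) \<and>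
     (\<exists>P. monotone_off \<Omega> (deriv3 \<Omega> \<phi>) P)}"

(* The constants of \<phi> as a member of A3: qs lists one quadruple (\<epsilon>, c1, c2, \<alpha>) per zero
   (so its length is the number of zeros), M bounds the number of changes of monotonicity,
   and m, K bound the modulus of the third derivative outside the \<epsilon>-neighbourhoods of its
   zeros.  The last two come from phi being C^4 up to the boundary and the zeros being the
   only ones; qs and M alone do not control the integral.  For instance, for
   phi(\<xi>) = - (b/2) ln (1 + d - \<xi>) on [0,1] there are no zeros and no changes of monotonicity,
   but at t = 1, x = 0 the integral has modulus 4 b powr (-2/3) if b ln ((1+d)/d) = 2 pi. *)
definition A3_constants ::
  "(real \<times> real \<times> real \<times> real) list \<Rightarrow> nat \<Rightarrow> real \<Rightarrow> real \<Rightarrow>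
     real set \<Rightarrow> (real \<Rightarrow> real) \<Rightarrow> bool" where
  "A3_constants qs M m K \<Omega> \<phi> \<longleftrightarrow>
     (\<exists>zs. distinct zs \<and> set zs = zeros3 \<Omega> \<phi> \<and> list_all2 (zero_bounds \<Omega> \<phi>) zs qs \<and>
        0 < m \<and>
        (\<forall>\<xi>\<in>\<Omega>. (\<forall>(z, \<epsilon>, _) \<in> set (zip zs qs). \<epsilon> \<le> \<bar>\<xi> - z\<bar>) \<longrightarrow>
           m \<le> \<bar>deriv3 \<Omega> \<phi> \<xi>\<bar> \<and> \<bar>deriv3 \<Omega> \<phi> \<xi>\<bar> \<le> K)) \<and>
     (\<exists>P. monotone_off \<Omega> (deriv3 \<Omega> \<phi>) P \<and> card P \<le> M)"

definition osc_integral :: "real set \<Rightarrow> (real \<Rightarrow> real) \<Rightarrow> real \<Rightarrow> real \<Rightarrow> complex" where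
  "osc_integral \<Omega> \<phi> x t =
     integral \<Omega> (\<lambda>\<xi>. exp (\<i> * complex_of_real (t * \<phi> \<xi> - x * \<xi>)) *
                      complex_of_real (\<bar>deriv3 \<Omega> \<phi> \<xi>\<bar> powr (1/3)))"

end

theory Submission
  imports Defs
begin

text \<open>
  Write $p(\<xi>) = t \<phi>(\<xi>) - x \<xi>$, so that $p''' = t \<phi>'''$. On an interval where
  $|\<phi>'''|$ lies between positive constants $m$ and $K$, the van der Corput estimate of order three
  bounds the integral of \<open>cis p\<close> by a multiple of $(m |t|)^{-1/3}$. The amplitude
  $|\<phi>'''|^{1/3}$ is at most $K^{1/3}$ and piecewise monotone, so by the second mean value theorem
  it costs only a constant factor (\<open>monotone_amplitude_bound\<close>). The length of the interval
  never enters.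

  The difficulty is a zero $z$ of $\<phi>'''$. With $u = |\<xi> - z|$ and $\<beta> = \<alpha> - 3$ one has
  $|\<phi>'''| \approx u^{\<beta>}$. On each dyadic shell around $z$ the order-three estimate gives the same
  bound $|t|^{-1/3}$, because the amplitude is the cube root of the third derivative: the estimate is
  scale invariant and cannot be summed over infinitely many shells. What saves the argument is the
  second derivative. On one side of $z$ it is strictly monotone and moves by about $|t| u^{\<beta>+1}$ over
  a shell, so it can be small only near a single distance $d$ from $z$, hence on boundedly many
  shells. On all other shells $|p''| \ge \<kappa> |t| u^{\<beta>+1}$, and the order-two estimate gives
  $|t|^{-1/2} u^{-(\<beta>+3)/6}$, which sums geometrically over the shells with
  $u \ge |t|^{-1/(\<beta>+3)}$ to a multiple of $|t|^{-1/3}$; the part closer to $z$ has that size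
  already by the trivial estimate. This is \<open>right_of_zero_bound\<close>, and
  \<open>left_of_zero_bound\<close> by reflection.

  Cutting \<open>\<Omega>\<close> at the zeros $z$, at the points $z \pm \<epsilon>$ and at the changes of
  monotonicity leaves a bounded number of intervals, each of one of these two kinds. That suitable
  constants exist for every member of the class follows from compactness.
\<close>


section \<open>Oscillatory integrals with a monotone amplitude\<close>

lemma second_mean_value_bound:
  fixes \<psi> g :: "real \<Rightarrow> real"
  assumes "a \<le> b" and g: "continuous_on {a..b} g"
    and mono: "mono_on {a..b} \<psi> \<or> antimono_on {a..b} \<psi>"
    and S: "\<And>x. x \<in> {a..b} \<Longrightarrow> \<bar>\<psi> x\<bar> \<le> S"
    and V: "\<And>c d. a \<le> c \<Longrightarrow> c \<le> d \<Longrightarrow> d \<le> b \<Longrightarrow> \<bar>integral {c..d} g\<bar> \<le> V"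
  shows "(\<lambda>x. \<psi> x * g x) integrable_on {a..b}"
    and "\<bar>integral {a..b} (\<lambda>x. \<psi> x * g x)\<bar> \<le> 2 * S * V"
proof -
  have int: "g integrable_on {a..b}" using g by (rule integrable_continuous_real)
  have "\<exists>c\<in>{a..b}. ((\<lambda>x. \<psi> x * g x) has_integral
      (\<psi> a * integral {a..c} g + \<psi> b * integral {c..b} g)) {a..b}"
    using mono
  proof
    assume "mono_on {a..b} \<psi>"
    then have "\<psi> x \<le> \<psi> y" if "a \<le> x" "x \<le> y" "y \<le> b" for x y
      using that by (auto simp: monotone_on_def)
    from second_mean_value_theorem_full[of g a b \<psi>, OF int \<open>a \<le> b\<close> this]
    show ?thesis by blast
  next
    assume "antimono_on {a..b} \<psi>"
    then have "- \<psi> x \<le> - \<psi> y" if "a \<le> x" "x \<le> y" "y \<le> b" for x y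
      using that by (auto simp: monotone_on_def)
    from second_mean_value_theorem_full[of g a b "\<lambda>x. - \<psi> x", OF int \<open>a \<le> b\<close> this]
    obtain c where "c \<in> {a..b}" and "((\<lambda>x. - \<psi> x * g x) has_integral
      (- \<psi> a * integral {a..c} g + - \<psi> b * integral {c..b} g)) {a..b}" by blast
    from this(1) has_integral_neg[OF this(2)] show ?thesis
      by (auto simp: algebra_simps)
  qed
  then obtain c where c: "c \<in> {a..b}" and I: "((\<lambda>x. \<psi> x * g x) has_integral
      (\<psi> a * integral {a..c} g + \<psi> b * integral {c..b} g)) {a..b}" by blast
  show "(\<lambda>x. \<psi> x * g x) integrable_on {a..b}"
    using I by blast
  have "0 \<le> S" using S[of a] \<open>a \<le> b\<close> by force
  have "\<bar>\<psi> a * integral {a..c} g\<bar> \<le> S * V" "\<bar>\<psi> b * integral {c..b} g\<bar> \<le> S * V"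
    unfolding abs_mult using c \<open>a \<le> b\<close> \<open>0 \<le> S\<close> by (auto intro!: mult_mono S V)
  then show "\<bar>integral {a..b} (\<lambda>x. \<psi> x * g x)\<bar> \<le> 2 * S * V"
    using integral_unique[OF I] by linarith
qed

text \<open>
  A monotone amplitude need not be differentiated: Bonnet's form of the second mean value theorem
  replaces it by its two endpoint values. The factor 4 is 2 endpoints times 2 for the real and
  imaginary parts.
\<close>

lemma monotone_amplitude_bound:
  fixes \<psi> :: "real \<Rightarrow> real" and g :: "real \<Rightarrow> complex"
  assumes "a \<le> b" and g: "continuous_on {a..b} g"
    and mono: "mono_on {a..b} \<psi> \<or> antimono_on {a..b} \<psi>"
    and S: "\<And>x. x \<in> {a..b} \<Longrightarrow> \<bar>\<psi> x\<bar> \<le> S"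
    and V: "\<And>c d. a \<le> c \<Longrightarrow> c \<le> d \<Longrightarrow> d \<le> b \<Longrightarrow> cmod (integral {c..d} g) \<le> V"
  shows "cmod (integral {a..b} (\<lambda>x. g x * complex_of_real (\<psi> x))) \<le> 4 * S * V"
proof -
  have int: "g integrable_on {c..d}" if "a \<le> c" "d \<le> b" for c d
    by (rule integrable_continuous_real, rule continuous_on_subset[OF g]) (use that in auto)
  have Re: "integral {c..d} (\<lambda>x. Re (g x)) = Re (integral {c..d} g)"
    and Im: "integral {c..d} (\<lambda>x. Im (g x)) = Im (integral {c..d} g)"
    if "a \<le> c" "d \<le> b" for c d
    using integral_linear[OF int[OF that] bounded_linear_Re]
      integral_linear[OF int[OF that] bounded_linear_Im] by (simp_all add: o_def)
  have VR: "\<bar>integral {c..d} (\<lambda>x. Re (g x))\<bar> \<le> V" "\<bar>integral {c..d} (\<lambda>x. Im (g x))\<bar> \<le> V"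
    if "a \<le> c" "c \<le> d" "d \<le> b" for c d
    using V[OF that] abs_Re_le_cmod[of "integral {c..d} g"] abs_Im_le_cmod[of "integral {c..d} g"]
    by (simp_all add: Re Im that)
  have R: "\<bar>integral {a..b} (\<lambda>x. \<psi> x * Re (g x))\<bar> \<le> 2 * S * V"
      and Ri: "(\<lambda>x. \<psi> x * Re (g x)) integrable_on {a..b}"
    by (rule second_mean_value_bound; use assms VR in \<open>auto intro: continuous_intros\<close>)+
  have I: "\<bar>integral {a..b} (\<lambda>x. \<psi> x * Im (g x))\<bar> \<le> 2 * S * V"
      and Ii: "(\<lambda>x. \<psi> x * Im (g x)) integrable_on {a..b}"
    by (rule second_mean_value_bound; use assms VR in \<open>auto intro: continuous_intros\<close>)+
  let ?J = "Complex (integral {a..b} (\<lambda>x. \<psi> x * Re (g x))) (integral {a..b} (\<lambda>x. \<psi> x * Im (g x)))"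
  have "((\<lambda>x. complex_of_real (\<psi> x * Re (g x)) + \<i> * complex_of_real (\<psi> x * Im (g x))) has_integral ?J) {a..b}"
    unfolding Complex_eq
    by (intro has_integral_add has_integral_mult_right has_integral_of_real integrable_integral Ri Ii)
  moreover have "(\<lambda>x. complex_of_real (\<psi> x * Re (g x)) + \<i> * complex_of_real (\<psi> x * Im (g x)))
      = (\<lambda>x. g x * complex_of_real (\<psi> x))"
    by (auto simp: complex_eq_iff)
  ultimately have "integral {a..b} (\<lambda>x. g x * complex_of_real (\<psi> x)) = ?J"
    by (simp add: integral_unique)
  then show ?thesis
    using cmod_le[of ?J] R I by simp
qed

lemma has_vector_derivative_cis:
  assumes "(p has_real_derivative d) (at x within A)"
  shows "((\<lambda>x. cis (p x)) has_vector_derivative \<i> * complex_of_real d * cis (p x)) (at x within A)"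
proof -
  have "(p has_derivative (\<lambda>h. h * d)) (at x within A)"
    using assms by (simp add: has_field_derivative_def mult_commute_abs)
  from has_derivative_cis[OF this] show ?thesis
    unfolding has_vector_derivative_def
    by (simp add: scaleR_conv_of_real mult_ac)
qed

text \<open>
  Conjugation changes the sign of the phase. This reduces phases whose derivative of the relevant
  order is negative to those for which it is positive.
\<close>

lemma cmod_integral_cis_minus:
  "cmod (integral A (\<lambda>x. cis (- p x) * complex_of_real (\<psi> x)))
   = cmod (integral A (\<lambda>x. cis (p x) * complex_of_real (\<psi> x)))"
proof -
  have "cnj (integral A (\<lambda>x. cis (p x) * complex_of_real (\<psi> x)))
     = integral A (\<lambda>x. cis (- p x) * complex_of_real (\<psi> x))"
    by (simp add: integral_cnj cis_cnj)
  then show ?thesis by (metis complex_mod_cnj)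
qed

lemma cmod_integral_cis_minus1:
  "cmod (integral A (\<lambda>x. cis (- p x))) = cmod (integral A (\<lambda>x. cis (p x)))"
  using cmod_integral_cis_minus[of A p "\<lambda>_. 1"] by simp

section \<open>Van der Corput estimates\<close>

lemma increment_le_of_derivative_le:
  fixes g h :: "real \<Rightarrow> real"
  assumes g: "\<And>x. x \<in> {a..b} \<Longrightarrow> (g has_real_derivative g' x) (at x within {a..b})"
    and h: "\<And>x. x \<in> {a..b} \<Longrightarrow> (h has_real_derivative h' x) (at x within {a..b})"
    and le: "\<And>x. x \<in> {a..b} \<Longrightarrow> h' x \<le> g' x"
    and uv: "a \<le> u" "u \<le> v" "v \<le> b"
  shows "h v - h u \<le> g v - g u"
proof (cases "u < v")
  case True
  have "((\<lambda>x. g x - h x) has_derivative (\<lambda>d. (g' x - h' x) * d)) (at x within {u..v})"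
    if "u \<le> x" "x \<le> v" for x
  proof -
    have "((\<lambda>x. g x - h x) has_real_derivative (g' x - h' x)) (at x within {a..b})"
      using that uv by (intro DERIV_diff g h) auto
    then have "((\<lambda>x. g x - h x) has_real_derivative (g' x - h' x)) (at x within {u..v})"
      by (rule DERIV_subset) (use uv in auto)
    then show ?thesis by (simp add: has_field_derivative_def)
  qed
  from mvt_simple[OF True this] obtain x where x: "x \<in> {u<..<v}"
    "(g v - h v) - (g u - h u) = (g' x - h' x) * (v - u)" by blast
  moreover have "0 \<le> (g' x - h' x) * (v - u)"
    using le[of x] x uv by auto
  ultimately show ?thesis by linarith
next
  case False
  then show ?thesis using uv by auto
qed

text \<open>
  For increasing \<open>h\<close>, the point \<open>c\<close> is the zero of \<open>g\<close> if there is
  one, and otherwise the endpoint at which \<open>g\<close> is closest to 0; from there \<open>g\<close>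
  moves away from 0 at least as fast as \<open>h\<close>. The case \<open>x = c\<close> is excluded because
  \<open>g c\<close> may have the wrong sign for one of the inequalities when \<open>c\<close> is an endpoint.
\<close>

lemma nearly_zero_point:
  fixes g h :: "real \<Rightarrow> real"
  assumes "a \<le> b" and cont: "continuous_on {a..b} g"
    and incr: "\<And>u v. a \<le> u \<Longrightarrow> u \<le> v \<Longrightarrow> v \<le> b \<Longrightarrow> h v - h u \<le> g v - g u"
  obtains c where "c \<in> {a..b}"
    and "\<And>x. a \<le> x \<Longrightarrow> x < c \<Longrightarrow> h c - h x \<le> - g x"
    and "\<And>x. c < x \<Longrightarrow> x \<le> b \<Longrightarrow> h x - h c \<le> g x"
proof -
  consider "0 \<le> g a" | "g b \<le> 0" | "g a \<le> 0" "0 \<le> g b" by linarith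
  then show thesis
  proof cases
    case 1
    show thesis
    proof (rule that[of a])
      show "h x - h a \<le> g x" if "a < x" "x \<le> b" for x
        using incr[of a x] that 1 by simp
    qed (use \<open>a \<le> b\<close> in auto)
  next
    case 2
    show thesis
    proof (rule that[of b])
      show "h b - h x \<le> - g x" if "a \<le> x" "x < b" for x
        using incr[of x b] that 2 by simp
    qed (use \<open>a \<le> b\<close> in auto)
  next
    case 3
    then obtain c where c: "a \<le> c" "c \<le> b" "g c = 0"
      using IVT'[of g a 0 b] \<open>a \<le> b\<close> cont by auto
    show thesis
    proof (rule that[of c])
      show "c \<in> {a..b}" using c by simp
      show "h c - h x \<le> - g x" if "a \<le> x" "x < c" for x
        using incr[of x c] that c by simp
      show "h x - h c \<le> g x" if "c < x" "x \<le> b" for x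
        using incr[of c x] that c by simp
    qed
  qed
qed

text \<open>
  Near the point \<open>c\<close>, where the derivative of the phase may be small, the integrand is
  estimated by 1; the rest consists of at most two intervals.
\<close>

lemma integral_split_three:
  fixes F :: "real \<Rightarrow> complex"
  assumes "a \<le> b" "c \<in> {a..b}" "0 < \<delta>" "0 \<le> V" and F: "continuous_on {a..b} F"
    and F1: "\<And>x. x \<in> {a..b} \<Longrightarrow> cmod (F x) \<le> 1"
    and left: "\<And>l r. a \<le> l \<Longrightarrow> l \<le> r \<Longrightarrow> r \<le> b \<Longrightarrow> r \<le> c - \<delta> \<Longrightarrow> cmod (integral {l..r} F) \<le> V"
    and right: "\<And>l r. a \<le> l \<Longrightarrow> l \<le> r \<Longrightarrow> r \<le> b \<Longrightarrow> c + \<delta> \<le> l \<Longrightarrow> cmod (integral {l..r} F) \<le> V"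
  shows "cmod (integral {a..b} F) \<le> 2 * V + 2 * \<delta>"
proof -
  define l where "l = max a (c - \<delta>)"
  define r where "r = min b (c + \<delta>)"
  have lr: "a \<le> l" "l \<le> r" "r \<le> b" "r - l \<le> 2 * \<delta>"
    using assms by (auto simp: l_def r_def)
  have int: "F integrable_on {c..d}" if "a \<le> c" "d \<le> b" for c d
    by (rule integrable_continuous_real, rule continuous_on_subset[OF F]) (use that in auto)
  have eq: "integral {a..b} F = integral {a..l} F + integral {l..r} F + integral {r..b} F"
    using Henstock_Kurzweil_Integration.integral_combine[of a l b F]
      Henstock_Kurzweil_Integration.integral_combine[of l r b F] int lr by (simp add: add.assoc)
  have "cmod (integral {a..l} F) \<le> V"
    using left[of a l] \<open>0 \<le> V\<close> \<open>a \<le> b\<close> lr by (cases "c - \<delta> \<le> a") (auto simp: l_def)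
  moreover have "cmod (integral {r..b} F) \<le> V"
    using right[of r b] \<open>0 \<le> V\<close> \<open>a \<le> b\<close> lr by (cases "b \<le> c + \<delta>") (auto simp: r_def)
  moreover have "cmod (integral {l..r} F) \<le> 1 * (r - l)"
    by (rule integral_bound) (use lr F1 in \<open>auto intro: continuous_on_subset[OF F]\<close>)
  ultimately have "cmod (integral {a..b} F) \<le> V + 1 * (r - l) + V"
    unfolding eq by (intro norm_triangle_mono)
  then show ?thesis using lr(4) by simp
qed

text \<open>
  Instead of integrating by parts, \<open>cis p\<close> is written as the exact derivative
  \<open>p1 * cis p\<close> (up to the factor \<open>\<i>\<close>) times the monotone amplitude
  \<open>1 / p1\<close>.
\<close>

lemma van_der_Corput_1:
  fixes p p1 :: "real \<Rightarrow> real"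
  assumes "a \<le> b" "0 < \<mu>"
    and p: "\<And>x. x \<in> {a..b} \<Longrightarrow> (p has_real_derivative p1 x) (at x within {a..b})"
    and cont: "continuous_on {a..b} p1"
    and mono: "mono_on {a..b} p1 \<or> antimono_on {a..b} p1"
    and ge: "(\<forall>x\<in>{a..b}. \<mu> \<le> p1 x) \<or> (\<forall>x\<in>{a..b}. p1 x \<le> - \<mu>)"
  shows "cmod (integral {a..b} (\<lambda>x. cis (p x))) \<le> 8 / \<mu>"
proof -
  have nz: "p1 x \<noteq> 0" if "x \<in> {a..b}" for x using ge that \<open>0 < \<mu>\<close> by fastforce
  have contp: "continuous_on {a..b} p" using p by (rule DERIV_continuous_on)
  have "cmod (integral {a..b} (\<lambda>x. complex_of_real (p1 x) * cis (p x) * complex_of_real (1 / p1 x)))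
      \<le> 4 * (1 / \<mu>) * 2"
  proof (rule monotone_amplitude_bound)
    show "continuous_on {a..b} (\<lambda>x. complex_of_real (p1 x) * cis (p x))"
      using cont contp by (intro continuous_intros)
    have sgn: "0 < p1 x * p1 y" if "x \<in> {a..b}" "y \<in> {a..b}" for x y
      using ge
    proof
      assume "\<forall>x\<in>{a..b}. \<mu> \<le> p1 x"
      with that have "\<mu> \<le> p1 x" "\<mu> \<le> p1 y" by blast+
      then show ?thesis using \<open>0 < \<mu>\<close> by simp
    next
      assume "\<forall>x\<in>{a..b}. p1 x \<le> - \<mu>"
      with that have "p1 x \<le> - \<mu>" "p1 y \<le> - \<mu>" by blast+
      then show ?thesis using \<open>0 < \<mu>\<close> by (simp add: mult_neg_neg)
    qed
    have inv: "1 / p1 y \<le> 1 / p1 x" if "p1 x \<le> p1 y" "x \<in> {a..b}" "y \<in> {a..b}" for x y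
      by (rule divide_left_mono[OF that(1) _ sgn[OF that(3,2)]]) simp
    show "mono_on {a..b} (\<lambda>x. 1 / p1 x) \<or> antimono_on {a..b} (\<lambda>x. 1 / p1 x)"
      using mono
    proof
      assume m: "mono_on {a..b} p1"
      have "antimono_on {a..b} (\<lambda>x. 1 / p1 x)"
        by (rule monotone_onI, rule inv) (use m in \<open>auto simp: monotone_on_def\<close>)
      then show ?thesis ..
    next
      assume m: "antimono_on {a..b} p1"
      have "mono_on {a..b} (\<lambda>x. 1 / p1 x)"
        by (rule mono_onI, rule inv) (use m in \<open>auto simp: monotone_on_def\<close>)
      then show ?thesis ..
    qed
    show "\<bar>1 / p1 x\<bar> \<le> 1 / \<mu>" if "x \<in> {a..b}" for x
    proof -
      have "\<mu> \<le> \<bar>p1 x\<bar>" using ge that by fastforce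
      then show ?thesis using \<open>0 < \<mu>\<close> by (simp add: frac_le)
    qed
    show "cmod (integral {c..d} (\<lambda>x. complex_of_real (p1 x) * cis (p x))) \<le> 2"
      if cd: "a \<le> c" "c \<le> d" "d \<le> b" for c d
    proof -
      have "((\<lambda>x. \<i> * complex_of_real (p1 x) * cis (p x)) has_integral cis (p d) - cis (p c)) {c..d}"
      proof (rule fundamental_theorem_of_calculus[OF \<open>c \<le> d\<close>])
        fix x assume "x \<in> {c..d}"
        then have "(p has_real_derivative p1 x) (at x within {c..d})"
          using cd by (intro DERIV_subset[OF p]) auto
        then show "((\<lambda>x. cis (p x)) has_vector_derivative \<i> * complex_of_real (p1 x) * cis (p x)) (at x within {c..d})"
          by (rule has_vector_derivative_cis)
      qed
      from has_integral_mult_right[OF this, of "-\<i>"]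
      have "integral {c..d} (\<lambda>x. complex_of_real (p1 x) * cis (p x)) = - \<i> * (cis (p d) - cis (p c))"
        by (intro integral_unique) (simp add: mult.assoc[symmetric])
      then show ?thesis
        using norm_triangle_ineq4[of "cis (p d)" "cis (p c)"] by (simp add: norm_mult)
    qed
  qed fact
  moreover have "integral {a..b} (\<lambda>x. complex_of_real (p1 x) * cis (p x) * complex_of_real (1 / p1 x))
      = integral {a..b} (\<lambda>x. cis (p x))"
    by (rule integral_cong) (use nz in auto)
  ultimately show ?thesis by simp
qed

text \<open>
  Outside a \<open>\<delta>\<close>-neighbourhood of the point where \<open>p1\<close> is closest to 0,
  $|p_1| \ge \<mu> \<delta>$, so the first-order estimate gives $8/(\<mu> \<delta>)$ on either side. The choice
  $\<delta> = \<mu>^{-1/2}$ balances this with the length $2\<delta>$ of the neighbourhood.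
\<close>

lemma van_der_Corput_2:
  fixes p p1 p2 :: "real \<Rightarrow> real"
  assumes "a \<le> b" "0 < \<mu>"
    and p: "\<And>x. x \<in> {a..b} \<Longrightarrow> (p has_real_derivative p1 x) (at x within {a..b})"
    and p1: "\<And>x. x \<in> {a..b} \<Longrightarrow> (p1 has_real_derivative p2 x) (at x within {a..b})"
    and ge: "(\<forall>x\<in>{a..b}. \<mu> \<le> p2 x) \<or> (\<forall>x\<in>{a..b}. p2 x \<le> - \<mu>)"
  shows "cmod (integral {a..b} (\<lambda>x. cis (p x))) \<le> 18 * \<mu> powr (-1/2)"
proof -
  have pos: "cmod (integral {a..b} (\<lambda>x. cis (p x))) \<le> 18 * \<mu> powr (-1/2)"
    if p: "\<And>x. x \<in> {a..b} \<Longrightarrow> (p has_real_derivative p1 x) (at x within {a..b})"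
    and p1: "\<And>x. x \<in> {a..b} \<Longrightarrow> (p1 has_real_derivative p2 x) (at x within {a..b})"
    and ge: "\<And>x. x \<in> {a..b} \<Longrightarrow> \<mu> \<le> p2 x" for p p1 p2 :: "real \<Rightarrow> real"
  proof -
    have cp: "continuous_on {a..b} p" and cp1: "continuous_on {a..b} p1"
      by (rule DERIV_continuous_on, fact)+
    have incr: "\<mu> * v - \<mu> * u \<le> p1 v - p1 u" if "a \<le> u" "u \<le> v" "v \<le> b" for u v
      by (rule increment_le_of_derivative_le[where h = "\<lambda>x. \<mu> * x" and h' = "\<lambda>_. \<mu>", OF p1])
        (use that ge in \<open>auto intro!: derivative_eq_intros\<close>)
    have mono: "mono_on {a..b} p1"
    proof (rule mono_onI)
      fix u v assume "u \<in> {a..b}" "v \<in> {a..b}" "u \<le> v"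
      moreover from this have "\<mu> * u \<le> \<mu> * v" using \<open>0 < \<mu>\<close> by simp
      ultimately show "p1 u \<le> p1 v" using incr[of u v] by simp
    qed
    obtain c where c: "c \<in> {a..b}"
      and below: "\<And>x. a \<le> x \<Longrightarrow> x < c \<Longrightarrow> \<mu> * c - \<mu> * x \<le> - p1 x"
      and above: "\<And>x. c < x \<Longrightarrow> x \<le> b \<Longrightarrow> \<mu> * x - \<mu> * c \<le> p1 x"
      using nearly_zero_point[OF \<open>a \<le> b\<close> cp1 incr] by blast
    define \<delta> where "\<delta> = \<mu> powr (-1/2)"
    have "0 < \<delta>" using \<open>0 < \<mu>\<close> by (simp add: \<delta>_def)
    have "\<mu> powr (1 + -1/2 + -1/2) = \<mu> * \<delta> * \<delta>"
      unfolding powr_add \<delta>_def using \<open>0 < \<mu>\<close> by simp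
    then have \<delta>: "\<mu> * \<delta> * \<delta> = 1" using \<open>0 < \<mu>\<close> by simp
    have vdc1: "cmod (integral {l..r} (\<lambda>x. cis (p x))) \<le> 8 * \<delta>"
      if lr: "a \<le> l" "l \<le> r" "r \<le> b"
        and far: "(\<forall>x\<in>{l..r}. \<mu> * \<delta> \<le> p1 x) \<or> (\<forall>x\<in>{l..r}. p1 x \<le> - (\<mu> * \<delta>))" for l r
    proof -
      have "cmod (integral {l..r} (\<lambda>x. cis (p x))) \<le> 8 / (\<mu> * \<delta>)"
      proof (rule van_der_Corput_1[where ?p1.0 = p1])
        show "(p has_real_derivative p1 x) (at x within {l..r})" if "x \<in> {l..r}" for x
          using that lr by (intro DERIV_subset[OF p]) auto
        show "continuous_on {l..r} p1" by (rule continuous_on_subset[OF cp1]) (use lr in auto)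
        show "mono_on {l..r} p1 \<or> antimono_on {l..r} p1"
          using mono_on_subset[OF mono, of "{l..r}"] lr by auto
      qed (use \<open>0 < \<mu>\<close> \<open>0 < \<delta>\<close> lr far in auto)
      also have "8 / (\<mu> * \<delta>) = 8 * \<delta>"
        using \<delta> \<open>0 < \<mu>\<close> \<open>0 < \<delta>\<close> by (simp add: field_simps)
      finally show ?thesis .
    qed
    have "cmod (integral {a..b} (\<lambda>x. cis (p x))) \<le> 2 * (8 * \<delta>) + 2 * \<delta>"
    proof (rule integral_split_three[OF \<open>a \<le> b\<close> c \<open>0 < \<delta>\<close>])
      show "cmod (integral {l..r} (\<lambda>x. cis (p x))) \<le> 8 * \<delta>"
        if "a \<le> l" "l \<le> r" "r \<le> b" "r \<le> c - \<delta>" for l r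
      proof (rule vdc1[OF that(1-3)], rule disjI2, rule ballI)
        fix x assume "x \<in> {l..r}"
        then have "a \<le> x" "x < c" "\<mu> * \<delta> \<le> \<mu> * (c - x)" using that \<open>0 < \<delta>\<close> \<open>0 < \<mu>\<close> by auto
        with below[of x] show "p1 x \<le> - (\<mu> * \<delta>)" by (simp add: right_diff_distrib)
      qed
      show "cmod (integral {l..r} (\<lambda>x. cis (p x))) \<le> 8 * \<delta>"
        if "a \<le> l" "l \<le> r" "r \<le> b" "c + \<delta> \<le> l" for l r
      proof (rule vdc1[OF that(1-3)], rule disjI1, rule ballI)
        fix x assume "x \<in> {l..r}"
        then have "c < x" "x \<le> b" "\<mu> * \<delta> \<le> \<mu> * (x - c)" using that \<open>0 < \<delta>\<close> \<open>0 < \<mu>\<close> by auto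
        with above[of x] show "\<mu> * \<delta> \<le> p1 x" by (simp add: right_diff_distrib)
      qed
    qed (use \<open>0 < \<delta>\<close> cp in \<open>auto intro: continuous_intros\<close>)
    then show ?thesis by (simp add: \<delta>_def)
  qed
  from ge show ?thesis
  proof
    assume "\<forall>x\<in>{a..b}. \<mu> \<le> p2 x"
    then show ?thesis using p p1 by (intro pos[of p p1 p2]) auto
  next
    assume neg: "\<forall>x\<in>{a..b}. p2 x \<le> - \<mu>"
    have "cmod (integral {a..b} (\<lambda>x. cis (- p x))) \<le> 18 * \<mu> powr (-1/2)"
      by (rule pos[of _ "\<lambda>x. - p1 x" "\<lambda>x. - p2 x"])
        (use neg in \<open>force intro: DERIV_minus p p1\<close>)+
    then show ?thesis by (simp add: cmod_integral_cis_minus1)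
  qed
qed

text \<open>
  The same step from order two to order three: now the balance of $(\<mu> \<delta>)^{-1/2}$ and
  \<open>\<delta>\<close> gives $\<delta> = \<mu>^{-1/3}$.
\<close>

lemma van_der_Corput_3:
  fixes p p1 p2 p3 :: "real \<Rightarrow> real"
  assumes "a \<le> b" "0 < \<mu>"
    and p: "\<And>x. x \<in> {a..b} \<Longrightarrow> (p has_real_derivative p1 x) (at x within {a..b})"
    and p1: "\<And>x. x \<in> {a..b} \<Longrightarrow> (p1 has_real_derivative p2 x) (at x within {a..b})"
    and p2: "\<And>x. x \<in> {a..b} \<Longrightarrow> (p2 has_real_derivative p3 x) (at x within {a..b})"
    and ge: "\<And>x. x \<in> {a..b} \<Longrightarrow> \<mu> \<le> p3 x"
  shows "cmod (integral {a..b} (\<lambda>x. cis (p x))) \<le> 38 * \<mu> powr (-1/3)"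
proof -
  have cp: "continuous_on {a..b} p" and cp2: "continuous_on {a..b} p2"
    by (rule DERIV_continuous_on, fact)+
  have incr: "\<mu> * v - \<mu> * u \<le> p2 v - p2 u" if "a \<le> u" "u \<le> v" "v \<le> b" for u v
    by (rule increment_le_of_derivative_le[where h = "\<lambda>x. \<mu> * x" and h' = "\<lambda>_. \<mu>", OF p2])
      (use that ge in \<open>auto intro!: derivative_eq_intros\<close>)
  obtain c where c: "c \<in> {a..b}"
    and below: "\<And>x. a \<le> x \<Longrightarrow> x < c \<Longrightarrow> \<mu> * c - \<mu> * x \<le> - p2 x"
    and above: "\<And>x. c < x \<Longrightarrow> x \<le> b \<Longrightarrow> \<mu> * x - \<mu> * c \<le> p2 x"
    using nearly_zero_point[OF \<open>a \<le> b\<close> cp2 incr] by blast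
  define \<delta> where "\<delta> = \<mu> powr (-1/3)"
  have "0 < \<delta>" using \<open>0 < \<mu>\<close> by (simp add: \<delta>_def)
  have "\<mu> powr (1 + -1/3) = \<mu> * \<delta>"
    unfolding powr_add \<delta>_def using \<open>0 < \<mu>\<close> by simp
  then have "(\<mu> * \<delta>) powr (-1/2) = (\<mu> powr (1 + -1/3)) powr (-1/2)" by simp
  then have \<delta>: "(\<mu> * \<delta>) powr (-1/2) = \<delta>"
    unfolding powr_powr by (simp add: \<delta>_def)
  have vdc2: "cmod (integral {l..r} (\<lambda>x. cis (p x))) \<le> 18 * \<delta>"
    if lr: "a \<le> l" "l \<le> r" "r \<le> b"
      and far: "(\<forall>x\<in>{l..r}. \<mu> * \<delta> \<le> p2 x) \<or> (\<forall>x\<in>{l..r}. p2 x \<le> - (\<mu> * \<delta>))" for l r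
  proof -
    have "cmod (integral {l..r} (\<lambda>x. cis (p x))) \<le> 18 * (\<mu> * \<delta>) powr (-1/2)"
    proof (rule van_der_Corput_2[where ?p1.0 = p1 and ?p2.0 = p2])
      show "(p has_real_derivative p1 x) (at x within {l..r})"
        "(p1 has_real_derivative p2 x) (at x within {l..r})" if "x \<in> {l..r}" for x
        using that lr by (auto intro!: DERIV_subset[OF p] DERIV_subset[OF p1])
    qed (use \<open>0 < \<mu>\<close> \<open>0 < \<delta>\<close> lr far in auto)
    then show ?thesis by (simp only: \<delta>)
  qed
  have "cmod (integral {a..b} (\<lambda>x. cis (p x))) \<le> 2 * (18 * \<delta>) + 2 * \<delta>"
  proof (rule integral_split_three[OF \<open>a \<le> b\<close> c \<open>0 < \<delta>\<close>])
    show "cmod (integral {l..r} (\<lambda>x. cis (p x))) \<le> 18 * \<delta>"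
      if "a \<le> l" "l \<le> r" "r \<le> b" "r \<le> c - \<delta>" for l r
    proof (rule vdc2[OF that(1-3)], rule disjI2, rule ballI)
      fix x assume "x \<in> {l..r}"
      then have "a \<le> x" "x < c" "\<mu> * \<delta> \<le> \<mu> * (c - x)" using that \<open>0 < \<delta>\<close> \<open>0 < \<mu>\<close> by auto
      with below[of x] show "p2 x \<le> - (\<mu> * \<delta>)" by (simp add: right_diff_distrib)
    qed
    show "cmod (integral {l..r} (\<lambda>x. cis (p x))) \<le> 18 * \<delta>"
      if "a \<le> l" "l \<le> r" "r \<le> b" "c + \<delta> \<le> l" for l r
    proof (rule vdc2[OF that(1-3)], rule disjI1, rule ballI)
      fix x assume "x \<in> {l..r}"
      then have "c < x" "x \<le> b" "\<mu> * \<delta> \<le> \<mu> * (x - c)" using that \<open>0 < \<delta>\<close> \<open>0 < \<mu>\<close> by auto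
      with above[of x] show "\<mu> * \<delta> \<le> p2 x" by (simp add: right_diff_distrib)
    qed
  qed (use \<open>0 < \<delta>\<close> cp in \<open>auto intro: continuous_intros\<close>)
  then show ?thesis by (simp add: \<delta>_def)
qed

section \<open>Near a zero of the third derivative\<close>

text \<open>
  Bounds on dyadic shells around \<open>z\<close> that decay like \<open>(l - z) powr (- q)\<close> form a
  geometric series of ratio \<open>2 powr (- q)\<close>, which is at most 3/4 for \<open>q \<ge> 1/2\<close>;
  its sum is at most four times its first term.
\<close>

lemma dyadic_chain:
  fixes F :: "real \<Rightarrow> complex"
  assumes "z < a" "a \<le> b" "0 \<le> D" "1/2 \<le> q" and F: "continuous_on {a..b} F"
    and shell: "\<And>l r. a \<le> l \<Longrightarrow> l \<le> r \<Longrightarrow> r \<le> b \<Longrightarrow> r - z \<le> 2 * (l - z) \<Longrightarrow>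
      cmod (integral {l..r} F) \<le> D * (l - z) powr (- q)"
  shows "cmod (integral {a..b} F) \<le> 4 * D * (a - z) powr (- q)"
proof -
  have "(4/3)\<^sup>2 \<le> (2::real)" by (simp add: power2_eq_square)
  then have "4/3 \<le> sqrt (2::real)" by (rule real_le_rsqrt)
  have "2 powr (- q) \<le> 2 powr (- (1/2))"
    using \<open>1/2 \<le> q\<close> by simp
  also have "\<dots> = inverse (2 powr (1/2))" by (rule powr_minus)
  also have "2 powr (1/2) = sqrt 2" by (rule powr_half_sqrt) simp
  also have "inverse (sqrt 2) \<le> 3/4" using \<open>4/3 \<le> sqrt 2\<close> by (simp add: field_simps)
  finally have two: "2 powr (- q) \<le> 3/4" .
  have "cmod (integral {l..b} F) \<le> 4 * D * (l - z) powr (- q)"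
    if "a \<le> l" "l \<le> b" "b - z \<le> 2 ^ n * (l - z)" for n l
    using that
  proof (induction n arbitrary: l)
    case 0
    then have "cmod (integral {l..b} F) \<le> D * (l - z) powr (- q)"
      using \<open>z < a\<close> by (intro shell) auto
    also have "\<dots> \<le> 4 * D * (l - z) powr (- q)"
      using \<open>0 \<le> D\<close> by (intro mult_right_mono) auto
    finally show ?case .
  next
    case (Suc n)
    show ?case
    proof (cases "b - z \<le> 2 * (l - z)")
      case True
      then have "cmod (integral {l..b} F) \<le> D * (l - z) powr (- q)"
        using Suc.prems by (intro shell) auto
      also have "\<dots> \<le> 4 * D * (l - z) powr (- q)"
        using \<open>0 \<le> D\<close> by (intro mult_right_mono) auto
      finally show ?thesis .
    next
      case False
      define m where "m = z + 2 * (l - z)"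
      have m: "l \<le> m" "m \<le> b" "m - z = 2 * (l - z)"
        using False Suc.prems \<open>z < a\<close> by (auto simp: m_def)
      have split: "integral {l..b} F = integral {l..m} F + integral {m..b} F"
      proof (rule Henstock_Kurzweil_Integration.integral_combine[symmetric, OF m(1,2)])
        show "F integrable_on {l..b}"
          using Suc.prems by (intro integrable_continuous_real continuous_on_subset[OF F]) auto
      qed
      have 1: "cmod (integral {l..m} F) \<le> D * (l - z) powr (- q)"
        using Suc.prems m by (intro shell) auto
      have "cmod (integral {m..b} F) \<le> 4 * D * (m - z) powr (- q)"
      proof (rule Suc.IH)
        show "b - z \<le> 2 ^ n * (m - z)"
          unfolding m(3) using Suc.prems(3) by (simp only: power_Suc mult_ac)
      qed (use Suc.prems(1) m in auto)
      also have "(m - z) powr (- q) = 2 powr (- q) * (l - z) powr (- q)"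
        unfolding m(3) by (rule powr_mult)
      also have "4 * D * \<dots> \<le> 4 * D * (3/4 * (l - z) powr (- q))"
        using \<open>0 \<le> D\<close> by (intro mult_left_mono mult_right_mono two) auto
      finally have 2: "cmod (integral {m..b} F) \<le> 3 * (D * (l - z) powr (- q))" by simp
      show ?thesis
        unfolding split using norm_triangle_ineq[of "integral {l..m} F" "integral {m..b} F"] 1 2
        by linarith
    qed
  qed
  moreover obtain n where "(b - z) / (a - z) < 2 ^ n"
    using real_arch_pow[of 2 "(b - z) / (a - z)"] by auto
  then have "b - z \<le> 2 ^ n * (a - z)"
    using \<open>z < a\<close> by (simp add: field_simps)
  ultimately show ?thesis using \<open>a \<le> b\<close> by blast
qed

text \<open>
  One shell, by the estimate of order two. Across a shell both \<open>x - z\<close> and the bound for the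
  amplitude vary by bounded factors only, so both may be evaluated at the inner end. The exponent of
  \<open>l - z\<close> is $\<beta>/3 - (\<beta>+1)/2 = -(\<beta>+3)/6$.
\<close>

lemma shell_bound:
  fixes p p1 p2 \<psi> :: "real \<Rightarrow> real"
  assumes "z < l" "l \<le> r" "r - z \<le> 2 * (l - z)" "0 < T" "0 < \<kappa>" "0 \<le> \<beta>" "0 \<le> S"
    and p: "\<And>x. x \<in> {l..r} \<Longrightarrow> (p has_real_derivative p1 x) (at x within {l..r})"
    and p1: "\<And>x. x \<in> {l..r} \<Longrightarrow> (p1 has_real_derivative p2 x) (at x within {l..r})"
    and ge: "(\<forall>x\<in>{l..r}. \<kappa> * T * (x - z) powr (\<beta> + 1) \<le> p2 x) \<or>
             (\<forall>x\<in>{l..r}. p2 x \<le> - (\<kappa> * T * (x - z) powr (\<beta> + 1)))"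
    and mono: "mono_on {l..r} \<psi> \<or> antimono_on {l..r} \<psi>"
    and \<psi>: "\<And>x. x \<in> {l..r} \<Longrightarrow> \<bar>\<psi> x\<bar> \<le> S * (x - z) powr (\<beta>/3)"
  shows "cmod (integral {l..r} (\<lambda>x. cis (p x) * complex_of_real (\<psi> x)))
    \<le> 72 * S * 2 powr (\<beta>/3) * \<kappa> powr (-1/2) * T powr (-1/2) * (l - z) powr (- ((\<beta> + 3)/6))"
proof -
  define L where "L = l - z"
  have "0 < L" using \<open>z < l\<close> by (simp add: L_def)
  define m where "m = \<kappa> * T * L powr (\<beta> + 1)"
  have "0 < m" using \<open>0 < L\<close> \<open>0 < T\<close> \<open>0 < \<kappa>\<close> by (simp add: m_def)
  have m_le: "m \<le> \<kappa> * T * (x - z) powr (\<beta> + 1)" if "x \<in> {l..r}" for x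
    unfolding m_def using that \<open>0 < L\<close> \<open>0 < T\<close> \<open>0 < \<kappa>\<close> \<open>0 \<le> \<beta>\<close>
    by (intro mult_left_mono powr_mono2) (auto simp: L_def)
  have "cmod (integral {l..r} (\<lambda>x. cis (p x) * complex_of_real (\<psi> x)))
     \<le> 4 * (S * (2 * L) powr (\<beta>/3)) * (18 * m powr (-1/2))"
  proof (rule monotone_amplitude_bound[OF \<open>l \<le> r\<close> _ mono])
    have "continuous_on {l..r} p" using p by (rule DERIV_continuous_on)
    then show "continuous_on {l..r} (\<lambda>x. cis (p x))" by (intro continuous_intros)
    show "\<bar>\<psi> x\<bar> \<le> S * (2 * L) powr (\<beta>/3)" if "x \<in> {l..r}" for x
    proof -
      have "(x - z) powr (\<beta>/3) \<le> (2 * L) powr (\<beta>/3)"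
        using that assms by (intro powr_mono2) (auto simp: L_def)
      from order_trans[OF \<psi>[OF that] mult_left_mono[OF this \<open>0 \<le> S\<close>]] show ?thesis .
    qed
    show "cmod (integral {c..d} (\<lambda>x. cis (p x))) \<le> 18 * m powr (-1/2)"
      if "l \<le> c" "c \<le> d" "d \<le> r" for c d
    proof (rule van_der_Corput_2[OF \<open>c \<le> d\<close> \<open>0 < m\<close>, where ?p1.0 = p1 and ?p2.0 = p2])
      show "(p has_real_derivative p1 x) (at x within {c..d})"
        "(p1 has_real_derivative p2 x) (at x within {c..d})" if "x \<in> {c..d}" for x
        using that \<open>l \<le> c\<close> \<open>d \<le> r\<close> by (auto intro!: DERIV_subset[OF p] DERIV_subset[OF p1])
      show "(\<forall>x\<in>{c..d}. m \<le> p2 x) \<or> (\<forall>x\<in>{c..d}. p2 x \<le> - m)"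
        using ge
      proof
        assume A: "\<forall>x\<in>{l..r}. \<kappa> * T * (x - z) powr (\<beta> + 1) \<le> p2 x"
        have "m \<le> p2 x" if "x \<in> {c..d}" for x
        proof -
          have x: "x \<in> {l..r}" using that \<open>l \<le> c\<close> \<open>d \<le> r\<close> by auto
          show ?thesis using m_le[OF x] bspec[OF A x] by linarith
        qed
        then show ?thesis by blast
      next
        assume A: "\<forall>x\<in>{l..r}. p2 x \<le> - (\<kappa> * T * (x - z) powr (\<beta> + 1))"
        have "p2 x \<le> - m" if "x \<in> {c..d}" for x
        proof -
          have x: "x \<in> {l..r}" using that \<open>l \<le> c\<close> \<open>d \<le> r\<close> by auto
          show ?thesis using m_le[OF x] bspec[OF A x] by linarith
        qed
        then show ?thesis by blast
      qed
    qed
  qed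
  also have "m powr (-1/2) = \<kappa> powr (-1/2) * T powr (-1/2) * L powr ((\<beta> + 1) * (-1/2))"
    unfolding m_def using \<open>0 < L\<close> \<open>0 < T\<close> \<open>0 < \<kappa>\<close> by (simp add: powr_mult powr_powr)
  also have "(2 * L) powr (\<beta>/3) = 2 powr (\<beta>/3) * L powr (\<beta>/3)"
    using \<open>0 < L\<close> by (simp add: powr_mult)
  also have "4 * (S * (2 powr (\<beta>/3) * L powr (\<beta>/3))) *
      (18 * (\<kappa> powr (-1/2) * T powr (-1/2) * L powr ((\<beta> + 1) * (-1/2))))
    = 72 * S * 2 powr (\<beta>/3) * \<kappa> powr (-1/2) * T powr (-1/2) *
       (L powr (\<beta>/3) * L powr ((\<beta> + 1) * (-1/2)))"
    by simp
  also have "L powr (\<beta>/3) * L powr ((\<beta> + 1) * (-1/2)) = L powr (- ((\<beta> + 3)/6))"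
    unfolding powr_add[symmetric] by (rule arg_cong[where f = "\<lambda>e. L powr e"]) (simp add: field_simps)
  finally show ?thesis by (simp add: L_def)
qed

text \<open>
  The four contributions in \<open>right_of_zero_bound\<close>: the innermost part, the shells on either
  side of the critical distance (one term each), and the part around the critical distance.
\<close>

definition near_zero_const :: "real \<Rightarrow> real \<Rightarrow> real \<Rightarrow> real" where
  "near_zero_const c1 \<beta> S =
     S + 2 * (288 * S * 2 powr (\<beta>/3) * (c1 / (2 * (\<beta> + 1))) powr (-1/2))
       + 152 * S * 4 powr (\<beta>/3) * c1 powr (-1/3)"

text \<open>
  The two-sided estimate of $\<phi>'''$ near a zero enters as a lower bound for \<open>p3\<close> and as an
  upper bound for the amplitude, where \<open>S\<close> stands for \<open>c2 powr (1/3)\<close>. Writing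
  \<open>c = z + d\<close> for the point where \<open>p2\<close> comes closest to 0, the interval splits
  into \<open>x - z \<le> r0\<close> (trivial bound), \<open>d/2 \<le> x - z \<le> 2 * d\<close> (order three)
  and the two remaining parts, in which \<open>p2\<close> is bounded below by the increment of \<open>h\<close>
  between \<open>x\<close> and \<open>c\<close> (order two on dyadic shells). Only lower bounds for increments
  of \<open>p2\<close> occur, so the bound is uniform in the value of \<open>p2\<close> at \<open>z\<close>.
\<close>

lemma right_of_zero_bound:
  fixes p p1 p2 p3 \<psi> :: "real \<Rightarrow> real"
  assumes "z < a" "a \<le> b" "0 < T" "0 < c1" "0 \<le> \<beta>" "0 \<le> S"
    and p: "\<And>x. x \<in> {a..b} \<Longrightarrow> (p has_real_derivative p1 x) (at x within {a..b})"
    and p1: "\<And>x. x \<in> {a..b} \<Longrightarrow> (p1 has_real_derivative p2 x) (at x within {a..b})"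
    and p2: "\<And>x. x \<in> {a..b} \<Longrightarrow> (p2 has_real_derivative p3 x) (at x within {a..b})"
    and ge: "\<And>x. x \<in> {a..b} \<Longrightarrow> T * c1 * (x - z) powr \<beta> \<le> p3 x"
    and mono: "mono_on {a..b} \<psi> \<or> antimono_on {a..b} \<psi>"
    and cont: "continuous_on {a..b} \<psi>"
    and \<psi>: "\<And>x. x \<in> {a..b} \<Longrightarrow> \<bar>\<psi> x\<bar> \<le> S * (x - z) powr (\<beta>/3)"
  shows "cmod (integral {a..b} (\<lambda>x. cis (p x) * complex_of_real (\<psi> x)))
    \<le> near_zero_const c1 \<beta> S * T powr (-1/3)"
proof -
  define F where "F = (\<lambda>x. cis (p x) * complex_of_real (\<psi> x))"
  have cp: "continuous_on {a..b} p" and cp2: "continuous_on {a..b} p2"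
    by (rule DERIV_continuous_on, fact)+
  have cF: "continuous_on {a..b} F"
    unfolding F_def using cp cont by (intro continuous_intros)
  have sub: "(p has_real_derivative p1 x) (at x within {l..r})"
      "(p1 has_real_derivative p2 x) (at x within {l..r})"
      "(p2 has_real_derivative p3 x) (at x within {l..r})"
    if "a \<le> l" "r \<le> b" "x \<in> {l..r}" for l r x
    using that by (auto intro!: DERIV_subset[OF p] DERIV_subset[OF p1] DERIV_subset[OF p2])
  have mono_sub: "mono_on {l..r} \<psi> \<or> antimono_on {l..r} \<psi>" if "a \<le> l" "r \<le> b" for l r
    using mono monotone_on_subset[of "{a..b}" _ _ \<psi> "{l..r}"] that by auto

  \<comment> \<open>the antiderivative of the lower bound for \<open>p3\<close>\<close>
  define h where "h x = T * c1 / (\<beta> + 1) * (x - z) powr (\<beta> + 1)" for x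
  have h: "(h has_real_derivative T * c1 * (x - z) powr \<beta>) (at x within {a..b})"
    if "x \<in> {a..b}" for x
  proof -
    have "((\<lambda>x. (x - z) powr (\<beta> + 1)) has_real_derivative (\<beta> + 1) * (x - z) powr \<beta>) (at x within {a..b})"
      using that \<open>z < a\<close> by (auto intro!: derivative_eq_intros)
    from DERIV_cmult[OF this, of "T * c1 / (\<beta> + 1)"] show ?thesis
      unfolding h_def using \<open>0 \<le> \<beta>\<close> by (simp add: mult.assoc)
  qed
  have incr: "h v - h u \<le> p2 v - p2 u" if "a \<le> u" "u \<le> v" "v \<le> b" for u v
    by (rule increment_le_of_derivative_le[OF p2 h ge that])
  obtain c where c: "c \<in> {a..b}"
    and below: "\<And>x. a \<le> x \<Longrightarrow> x < c \<Longrightarrow> h c - h x \<le> - p2 x"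
    and above: "\<And>x. c < x \<Longrightarrow> x \<le> b \<Longrightarrow> h x - h c \<le> p2 x"
    using nearly_zero_point[OF \<open>a \<le> b\<close> cp2 incr] by blast
  define d where "d = c - z"
  have "0 < d" using c \<open>z < a\<close> by (simp add: d_def)
  \<comment> \<open>\<open>\<kappa> * T\<close> is half the coefficient of \<open>h\<close>: when the distances of \<open>x\<close> and \<open>c\<close> from \<open>z\<close> differ by a
      factor 2 or more, the difference of \<open>h x\<close> and \<open>h c\<close> is at least half the larger value\<close>
  define \<kappa> where "\<kappa> = c1 / (2 * (\<beta> + 1))"
  have "0 < \<kappa>" using \<open>0 < c1\<close> \<open>0 \<le> \<beta>\<close> by (simp add: \<kappa>_def)
  have h_eq: "h x = 2 * (\<kappa> * T * (x - z) powr (\<beta> + 1))" for x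
    using \<open>0 \<le> \<beta>\<close> by (simp add: h_def \<kappa>_def field_simps)
  have double: "2 * h x \<le> h y" if "z \<le> x" "2 * (x - z) \<le> y - z" for x y
  proof -
    have "2 * (x - z) powr (\<beta> + 1) \<le> 2 powr (\<beta> + 1) * (x - z) powr (\<beta> + 1)"
      using powr_mono[of 1 "\<beta> + 1" 2] \<open>0 \<le> \<beta>\<close> by (intro mult_right_mono) auto
    also have "\<dots> = (2 * (x - z)) powr (\<beta> + 1)"
      by (rule powr_mult[symmetric])
    also have "\<dots> \<le> (y - z) powr (\<beta> + 1)"
      using that \<open>0 \<le> \<beta>\<close> by (intro powr_mono2) auto
    finally have "T * c1 / (\<beta> + 1) * (2 * (x - z) powr (\<beta> + 1)) \<le> h y"
      unfolding h_def using assms by (intro mult_left_mono) auto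
    then show ?thesis by (simp add: h_def mult_ac)
  qed

  \<comment> \<open>the distance at which the trivial bound \<open>S * r0 powr (\<beta>/3 + 1)\<close>
      equals \<open>S * T powr (-1/3)\<close>\<close>
  define r0 where "r0 = T powr (- 1 / (\<beta> + 3))"
  have "0 < r0" using \<open>0 < T\<close> by (simp add: r0_def)
  define D where "D = 72 * S * 2 powr (\<beta>/3) * \<kappa> powr (-1/2)"
  have "0 \<le> D" using \<open>0 \<le> S\<close> by (simp add: D_def)

  have inner: "cmod (integral {l..r} F) \<le> S * T powr (-1/3)"
    if lr: "a \<le> l" "l \<le> r" "r \<le> b" "r - z \<le> r0" for l r
  proof -
    have "cmod (integral {l..r} F) \<le> (S * r0 powr (\<beta>/3)) * (r - l)"
    proof (rule integral_bound[OF \<open>l \<le> r\<close>])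
      show "continuous_on {l..r} F" by (rule continuous_on_subset[OF cF]) (use lr in auto)
      fix x assume x: "x \<in> {l..r}"
      have "cmod (F x) = \<bar>\<psi> x\<bar>" by (simp add: F_def norm_mult)
      also have "\<dots> \<le> S * (x - z) powr (\<beta>/3)" using x lr by (intro \<psi>) auto
      also have "\<dots> \<le> S * r0 powr (\<beta>/3)"
        using x lr \<open>z < a\<close> \<open>0 \<le> \<beta>\<close> \<open>0 \<le> S\<close> by (intro mult_left_mono powr_mono2) auto
      finally show "cmod (F x) \<le> S * r0 powr (\<beta>/3)" .
    qed
    also have "\<dots> \<le> (S * r0 powr (\<beta>/3)) * r0"
      using lr \<open>z < a\<close> \<open>0 \<le> S\<close> by (intro mult_left_mono) auto
    also have "\<dots> = S * (r0 powr (\<beta>/3) * r0 powr 1)" using \<open>0 < r0\<close> by simp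
    also have "r0 powr (\<beta>/3) * r0 powr 1 = T powr (- 1 / (\<beta> + 3) * (\<beta>/3 + 1))"
      unfolding powr_add[symmetric] unfolding r0_def powr_powr ..
    also have "- 1 / (\<beta> + 3) * (\<beta>/3 + 1) = -1/3" using \<open>0 \<le> \<beta>\<close> by (simp add: field_simps)
    finally show ?thesis .
  qed

  have outer: "cmod (integral {l..r} F) \<le> 4 * D * T powr (-1/3)"
    if lr: "a \<le> l" "l \<le> r" "r \<le> b" "r0 \<le> l - z"
      and far: "(\<forall>x\<in>{l..r}. \<kappa> * T * (x - z) powr (\<beta> + 1) \<le> p2 x) \<or>
             (\<forall>x\<in>{l..r}. p2 x \<le> - (\<kappa> * T * (x - z) powr (\<beta> + 1)))" for l r
  proof -
    have "cmod (integral {l..r} F) \<le> 4 * (D * T powr (-1/2)) * (l - z) powr (- ((\<beta> + 3)/6))"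
    proof (rule dyadic_chain)
      show "continuous_on {l..r} F" by (rule continuous_on_subset[OF cF]) (use lr in auto)
      show "cmod (integral {l'..r'} F) \<le> D * T powr (-1/2) * (l' - z) powr (- ((\<beta> + 3)/6))"
        if "l \<le> l'" "l' \<le> r'" "r' \<le> r" "r' - z \<le> 2 * (l' - z)" for l' r'
        unfolding F_def D_def
      proof (rule shell_bound[where ?p1.0 = p1 and ?p2.0 = p2])
        show "(\<forall>x\<in>{l'..r'}. \<kappa> * T * (x - z) powr (\<beta> + 1) \<le> p2 x) \<or>
             (\<forall>x\<in>{l'..r'}. p2 x \<le> - (\<kappa> * T * (x - z) powr (\<beta> + 1)))"
          using far that by auto
        show "mono_on {l'..r'} \<psi> \<or> antimono_on {l'..r'} \<psi>"
          using that lr by (intro mono_sub) auto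
      qed (use that lr assms \<open>0 < \<kappa>\<close> in \<open>auto intro!: sub \<psi>\<close>)
    qed (use lr \<open>z < a\<close> \<open>0 \<le> D\<close> \<open>0 \<le> \<beta>\<close> in auto)
    also have "\<dots> \<le> 4 * (D * T powr (-1/2)) * r0 powr (- ((\<beta> + 3)/6))"
      using lr \<open>0 < r0\<close> \<open>0 \<le> D\<close> \<open>0 \<le> \<beta>\<close> by (intro mult_left_mono powr_mono2') auto
    also have "r0 powr (- ((\<beta> + 3)/6)) = T powr (1/6)"
      using \<open>0 \<le> \<beta>\<close> by (simp add: r0_def powr_powr)
    also have "4 * (D * T powr (-1/2)) * T powr (1/6) = 4 * D * T powr (-1/2 + 1/6)"
      unfolding powr_add by simp
    finally show ?thesis by simp
  qed

  have middle: "cmod (integral {l..r} F) \<le> 152 * S * 4 powr (\<beta>/3) * c1 powr (-1/3) * T powr (-1/3)"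
    if lr: "a \<le> l" "l \<le> r" "r \<le> b" "d/2 \<le> l - z" "r - z \<le> 2 * d" for l r
  proof -
    define m where "m = T * c1 * (d/2) powr \<beta>"
    have "0 < m" using \<open>0 < T\<close> \<open>0 < c1\<close> \<open>0 < d\<close> by (simp add: m_def)
    have "cmod (integral {l..r} F) \<le> 4 * (S * (2 * d) powr (\<beta>/3)) * (38 * m powr (-1/3))"
      unfolding F_def
    proof (rule monotone_amplitude_bound[OF \<open>l \<le> r\<close>])
      have "continuous_on {l..r} p" by (rule continuous_on_subset[OF cp]) (use lr in auto)
      then show "continuous_on {l..r} (\<lambda>x. cis (p x))" by (intro continuous_intros)
      show "mono_on {l..r} \<psi> \<or> antimono_on {l..r} \<psi>" using lr by (intro mono_sub) auto
      show "\<bar>\<psi> x\<bar> \<le> S * (2 * d) powr (\<beta>/3)" if "x \<in> {l..r}" for x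
      proof -
        have "(x - z) powr (\<beta>/3) \<le> (2 * d) powr (\<beta>/3)"
          using that lr assms by (intro powr_mono2) auto
        moreover have "\<bar>\<psi> x\<bar> \<le> S * (x - z) powr (\<beta>/3)" using that lr by (intro \<psi>) auto
        ultimately show ?thesis using mult_left_mono \<open>0 \<le> S\<close> order_trans by blast
      qed
      show "cmod (integral {u..v} (\<lambda>x. cis (p x))) \<le> 38 * m powr (-1/3)"
        if uv: "l \<le> u" "u \<le> v" "v \<le> r" for u v
      proof (rule van_der_Corput_3[OF \<open>u \<le> v\<close> \<open>0 < m\<close>, where ?p1.0 = p1 and ?p2.0 = p2 and ?p3.0 = p3])
        fix x assume x: "x \<in> {u..v}"
        show "(p has_real_derivative p1 x) (at x within {u..v})"
          "(p1 has_real_derivative p2 x) (at x within {u..v})"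
          "(p2 has_real_derivative p3 x) (at x within {u..v})"
          using x uv lr by (auto intro!: sub)
        have "m \<le> T * c1 * (x - z) powr \<beta>"
          unfolding m_def using x uv lr assms \<open>0 < d\<close> by (intro mult_left_mono powr_mono2) auto
        also have "\<dots> \<le> p3 x" using x uv lr by (intro ge) auto
        finally show "m \<le> p3 x" .
      qed
    qed
    also have "m powr (-1/3) = c1 powr (-1/3) * T powr (-1/3) * (d/2) powr (- (\<beta>/3))"
      unfolding m_def using \<open>0 < d\<close> \<open>0 < T\<close> \<open>0 < c1\<close> by (simp add: powr_mult powr_powr)
    also have "2 * d = 4 * (d/2)" by simp
    also have "(4 * (d/2)) powr (\<beta>/3) = 4 powr (\<beta>/3) * (d/2) powr (\<beta>/3)"
      by (rule powr_mult)
    also have "4 * (S * (4 powr (\<beta>/3) * (d/2) powr (\<beta>/3))) *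
        (38 * (c1 powr (-1/3) * T powr (-1/3) * (d/2) powr (- (\<beta>/3))))
      = 152 * S * 4 powr (\<beta>/3) * c1 powr (-1/3) * T powr (-1/3) *
          ((d/2) powr (\<beta>/3) * (d/2) powr (- (\<beta>/3)))"
      by simp
    also have "(d/2) powr (\<beta>/3) * (d/2) powr (- (\<beta>/3)) = 1"
      unfolding powr_add[symmetric] using \<open>0 < d\<close> by simp
    finally show ?thesis by simp
  qed

  \<comment> \<open>the cut points are clamped to \<open>{a..b}\<close> and put in increasing order, so any of the
      four parts may be degenerate\<close>
  define x1 where "x1 = min b (max a (z + r0))"
  define x2 where "x2 = min b (max x1 (z + d/2))"
  define x3 where "x3 = min b (max x2 (z + 2 * d))"
  have xs: "a \<le> x1" "x1 \<le> x2" "x2 \<le> x3" "x3 \<le> b"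
    using \<open>a \<le> b\<close> by (auto simp: x1_def x2_def x3_def)
  have nonneg: "0 \<le> S * T powr (-1/3)" "0 \<le> 4 * D * T powr (-1/3)"
      "0 \<le> 152 * S * 4 powr (\<beta>/3) * c1 powr (-1/3) * T powr (-1/3)"
    using \<open>0 \<le> S\<close> \<open>0 \<le> D\<close> by auto
  have 1: "cmod (integral {a..x1} F) \<le> S * T powr (-1/3)"
  proof (cases "a < x1")
    case True
    then show ?thesis using xs by (intro inner) (auto simp: x1_def)
  next
    case False
    then show ?thesis using xs(1) nonneg by simp
  qed
  have 2: "cmod (integral {x1..x2} F) \<le> 4 * D * T powr (-1/3)"
  proof (cases "x1 < x2")
    case True
    then have "x2 \<le> z + d/2" by (auto simp: x2_def max_def min_def split: if_splits)
    have "x1 < b" using True xs by linarith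
    then have "r0 \<le> x1 - z" by (auto simp: x1_def)
    note \<open>x2 \<le> z + d/2\<close> this
    moreover have "p2 x \<le> - (\<kappa> * T * (x - z) powr (\<beta> + 1))" if "x \<in> {x1..x2}" for x
    proof -
      have "x \<le> z + d/2" using that \<open>x2 \<le> z + d/2\<close> by simp
      then have "2 * (x - z) \<le> c - z" unfolding d_def by argo
      then have "2 * h x \<le> h c" using that xs \<open>z < a\<close> by (intro double) auto
      moreover have "h c - h x \<le> - p2 x"
      proof (rule below)
        have "x < z + d" using \<open>x \<le> z + d/2\<close> \<open>0 < d\<close> by linarith
        then show "x < c" by (simp add: d_def)
      qed (use that xs in auto)
      moreover have "0 \<le> h x" using assms by (simp add: h_def)
      ultimately show ?thesis using h_eq[of x] by linarith
    qed
    ultimately show ?thesis using xs by (intro outer) auto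
  next
    case False
    then show ?thesis using xs(2) nonneg by simp
  qed
  have 3: "cmod (integral {x2..x3} F) \<le> 152 * S * 4 powr (\<beta>/3) * c1 powr (-1/3) * T powr (-1/3)"
  proof (cases "x2 < x3")
    case True
    then have "x3 \<le> z + 2 * d" by (auto simp: x3_def max_def min_def split: if_splits)
    have "x2 < b" using True xs by linarith
    then have "z + d/2 \<le> x2" by (auto simp: x2_def)
    show ?thesis
      by (rule middle) (use xs \<open>x3 \<le> z + 2 * d\<close> \<open>z + d/2 \<le> x2\<close> in linarith)+
  next
    case False
    then show ?thesis using xs(3) nonneg by simp
  qed
  have 4: "cmod (integral {x3..b} F) \<le> 4 * D * T powr (-1/3)"
  proof (cases "x3 < b")
    case True
    then have "z + 2 * d \<le> x3" by (auto simp: x3_def)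
    have "x1 < b" using True xs by linarith
    then have "r0 \<le> x1 - z" by (auto simp: x1_def)
    then have "r0 \<le> x3 - z" using xs by linarith
    note \<open>z + 2 * d \<le> x3\<close> this
    moreover have "\<kappa> * T * (x - z) powr (\<beta> + 1) \<le> p2 x" if "x \<in> {x3..b}" for x
    proof -
      have "2 * h c \<le> h x" using that xs c \<open>z < a\<close> \<open>z + 2 * d \<le> x3\<close> by (intro double) (auto simp: d_def)
      moreover have "h x - h c \<le> p2 x"
        using that xs \<open>z + 2 * d \<le> x3\<close> \<open>0 < d\<close> by (intro above) (auto simp: d_def)
      moreover have "0 \<le> h x" using assms by (simp add: h_def)
      ultimately show ?thesis using h_eq[of x] by linarith
    qed
    ultimately show ?thesis using xs by (intro outer) auto
  next
    case False
    then show ?thesis using xs(4) nonneg by simp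
  qed
  have int: "F integrable_on {u..v}" if "a \<le> u" "v \<le> b" for u v
    by (rule integrable_continuous_real, rule continuous_on_subset[OF cF]) (use that in auto)
  have split: "integral {a..b} F
      = integral {a..x1} F + (integral {x1..x2} F + (integral {x2..x3} F + integral {x3..b} F))"
    using Henstock_Kurzweil_Integration.integral_combine[of a x1 b F]
      Henstock_Kurzweil_Integration.integral_combine[of x1 x2 b F]
      Henstock_Kurzweil_Integration.integral_combine[of x2 x3 b F] int xs by simp
  have "cmod (integral {a..b} F) \<le> S * T powr (-1/3) + (4 * D * T powr (-1/3)
      + (152 * S * 4 powr (\<beta>/3) * c1 powr (-1/3) * T powr (-1/3) + 4 * D * T powr (-1/3)))"
    unfolding split by (intro norm_triangle_mono 1 2 3 4)
  also have "\<dots> = near_zero_const c1 \<beta> S * T powr (-1/3)"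
    by (simp add: near_zero_const_def D_def \<kappa>_def algebra_simps)
  finally show ?thesis by (simp add: F_def)
qed

lemma has_real_derivative_reflect:
  fixes f :: "real \<Rightarrow> real"
  assumes "(f has_real_derivative D) (at (- x) within {a..b})"
  shows "((\<lambda>x. f (- x)) has_real_derivative - D) (at x within {- b..- a})"
proof -
  have "(f \<circ> uminus has_real_derivative D * (- 1)) (at x within {- b..- a})"
    by (rule DERIV_image_chain) (use assms in \<open>auto intro!: derivative_eq_intros\<close>)
  then show ?thesis by (simp add: o_def)
qed

lemma near_zero_const_nonneg: "0 \<le> S \<Longrightarrow> 0 \<le> near_zero_const c1 \<beta> S"
  by (simp add: near_zero_const_def)

text \<open>
  Under the reflection \<open>x \<mapsto> - x\<close> the third derivative changes sign, which is undone
  by also negating the phase.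
\<close>

lemma left_of_zero_bound:
  fixes p p1 p2 p3 \<psi> :: "real \<Rightarrow> real"
  assumes "b < z" "a \<le> b" "0 < T" "0 < c1" "0 \<le> \<beta>" "0 \<le> S"
    and p: "\<And>x. x \<in> {a..b} \<Longrightarrow> (p has_real_derivative p1 x) (at x within {a..b})"
    and p1: "\<And>x. x \<in> {a..b} \<Longrightarrow> (p1 has_real_derivative p2 x) (at x within {a..b})"
    and p2: "\<And>x. x \<in> {a..b} \<Longrightarrow> (p2 has_real_derivative p3 x) (at x within {a..b})"
    and ge: "\<And>x. x \<in> {a..b} \<Longrightarrow> T * c1 * (z - x) powr \<beta> \<le> p3 x"
    and mono: "mono_on {a..b} \<psi> \<or> antimono_on {a..b} \<psi>"
    and cont: "continuous_on {a..b} \<psi>"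
    and \<psi>: "\<And>x. x \<in> {a..b} \<Longrightarrow> \<bar>\<psi> x\<bar> \<le> S * (z - x) powr (\<beta>/3)"
  shows "cmod (integral {a..b} (\<lambda>x. cis (p x) * complex_of_real (\<psi> x)))
    \<le> near_zero_const c1 \<beta> S * T powr (-1/3)"
proof -
  have "cmod (integral {- b..- a} (\<lambda>x. cis (- p (- x)) * complex_of_real (\<psi> (- x))))
    \<le> near_zero_const c1 \<beta> S * T powr (-1/3)"
  proof (rule right_of_zero_bound[of "- z" "- b" "- a" T c1 \<beta> S "\<lambda>x. - p (- x)" "\<lambda>x. p1 (- x)"
        "\<lambda>x. - p2 (- x)" "\<lambda>x. p3 (- x)" "\<lambda>x. \<psi> (- x)"])
    fix x assume "x \<in> {- b..- a}"
    then have x: "- x \<in> {a..b}" by auto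
    show "((\<lambda>x. - p (- x)) has_real_derivative p1 (- x)) (at x within {- b..- a})"
      using DERIV_minus[OF has_real_derivative_reflect[OF p[OF x]]] by simp
    show "((\<lambda>x. p1 (- x)) has_real_derivative - p2 (- x)) (at x within {- b..- a})"
      by (rule has_real_derivative_reflect[OF p1[OF x]])
    show "((\<lambda>x. - p2 (- x)) has_real_derivative p3 (- x)) (at x within {- b..- a})"
      using DERIV_minus[OF has_real_derivative_reflect[OF p2[OF x]]] by simp
    show "T * c1 * (x - - z) powr \<beta> \<le> p3 (- x)" using ge[OF x] by (simp add: add.commute)
    show "\<bar>\<psi> (- x)\<bar> \<le> S * (x - - z) powr (\<beta>/3)" using \<psi>[OF x] by (simp add: add.commute)
  next
    show "mono_on {- b..- a} (\<lambda>x. \<psi> (- x)) \<or> antimono_on {- b..- a} (\<lambda>x. \<psi> (- x))"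
      using mono by (auto simp: monotone_on_def)
    show "continuous_on {- b..- a} (\<lambda>x. \<psi> (- x))"
      by (rule continuous_on_compose2[OF cont]) (auto intro: continuous_intros)
  qed (use assms(1-6) in auto)
  also have "integral {- b..- a} (\<lambda>x. cis (- p (- x)) * complex_of_real (\<psi> (- x)))
      = integral {a..b} (\<lambda>x. cis (- p x) * complex_of_real (\<psi> x))"
    by (rule Henstock_Kurzweil_Integration.integral_reflect_real)
  finally show ?thesis unfolding cmod_integral_cis_minus .
qed

lemma one_sided_zero_bound:
  fixes p p1 p2 p3 \<psi> :: "real \<Rightarrow> real"
  assumes side: "z < a \<or> b < z" and "a \<le> b" "0 < T" "0 < c1" "0 \<le> \<beta>" "0 \<le> S"
    and p: "\<And>x. x \<in> {a..b} \<Longrightarrow> (p has_real_derivative p1 x) (at x within {a..b})"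
    and p1: "\<And>x. x \<in> {a..b} \<Longrightarrow> (p1 has_real_derivative p2 x) (at x within {a..b})"
    and p2: "\<And>x. x \<in> {a..b} \<Longrightarrow> (p2 has_real_derivative p3 x) (at x within {a..b})"
    and ge: "(\<forall>x\<in>{a..b}. T * c1 * \<bar>x - z\<bar> powr \<beta> \<le> p3 x) \<or>
             (\<forall>x\<in>{a..b}. p3 x \<le> - (T * c1 * \<bar>x - z\<bar> powr \<beta>))"
    and mono: "mono_on {a..b} \<psi> \<or> antimono_on {a..b} \<psi>"
    and cont: "continuous_on {a..b} \<psi>"
    and \<psi>: "\<And>x. x \<in> {a..b} \<Longrightarrow> \<bar>\<psi> x\<bar> \<le> S * \<bar>x - z\<bar> powr (\<beta>/3)"
  shows "cmod (integral {a..b} (\<lambda>x. cis (p x) * complex_of_real (\<psi> x)))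
    \<le> near_zero_const c1 \<beta> S * T powr (-1/3)"
proof -
  have pos: "cmod (integral {a..b} (\<lambda>x. cis (q x) * complex_of_real (\<psi> x)))
    \<le> near_zero_const c1 \<beta> S * T powr (-1/3)"
    if q: "\<And>x. x \<in> {a..b} \<Longrightarrow> (q has_real_derivative q1 x) (at x within {a..b})"
    and q1: "\<And>x. x \<in> {a..b} \<Longrightarrow> (q1 has_real_derivative q2 x) (at x within {a..b})"
    and q2: "\<And>x. x \<in> {a..b} \<Longrightarrow> (q2 has_real_derivative q3 x) (at x within {a..b})"
    and ge: "\<And>x. x \<in> {a..b} \<Longrightarrow> T * c1 * \<bar>x - z\<bar> powr \<beta> \<le> q3 x"
  for q q1 q2 q3 :: "real \<Rightarrow> real"
    using side
  proof
    assume "z < a"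
    then have abs: "\<bar>x - z\<bar> = x - z" if "x \<in> {a..b}" for x using that by auto
    show ?thesis
      using ge \<psi>
      by (intro right_of_zero_bound[OF \<open>z < a\<close> assms(2-6) q q1 q2 _ mono cont]) (auto simp: abs)
  next
    assume "b < z"
    then have abs: "\<bar>x - z\<bar> = z - x" if "x \<in> {a..b}" for x using that by auto
    show ?thesis
      using ge \<psi>
      by (intro left_of_zero_bound[OF \<open>b < z\<close> assms(2-6) q q1 q2 _ mono cont]) (auto simp: abs)
  qed
  from ge show ?thesis
  proof
    assume "\<forall>x\<in>{a..b}. T * c1 * \<bar>x - z\<bar> powr \<beta> \<le> p3 x"
    then show ?thesis by (intro pos[OF p p1 p2]) auto
  next
    assume neg: "\<forall>x\<in>{a..b}. p3 x \<le> - (T * c1 * \<bar>x - z\<bar> powr \<beta>)"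
    have "T * c1 * \<bar>x - z\<bar> powr \<beta> \<le> - p3 x" if "x \<in> {a..b}" for x
      using bspec[OF neg that] by linarith
    from pos[OF DERIV_minus[OF p] DERIV_minus[OF p1] DERIV_minus[OF p2] this]
    show ?thesis by (simp add: cmod_integral_cis_minus)
  qed
qed

section \<open>Assembling the pieces\<close>

lemma away_from_zeros_bound:
  fixes p p1 p2 p3 \<psi> :: "real \<Rightarrow> real"
  assumes "a \<le> b" "0 < T" "0 < m"
    and p: "\<And>x. x \<in> {a..b} \<Longrightarrow> (p has_real_derivative p1 x) (at x within {a..b})"
    and p1: "\<And>x. x \<in> {a..b} \<Longrightarrow> (p1 has_real_derivative p2 x) (at x within {a..b})"
    and p2: "\<And>x. x \<in> {a..b} \<Longrightarrow> (p2 has_real_derivative p3 x) (at x within {a..b})"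
    and ge: "(\<forall>x\<in>{a..b}. T * m \<le> p3 x) \<or> (\<forall>x\<in>{a..b}. p3 x \<le> - (T * m))"
    and mono: "mono_on {a..b} \<psi> \<or> antimono_on {a..b} \<psi>"
    and \<psi>: "\<And>x. x \<in> {a..b} \<Longrightarrow> \<bar>\<psi> x\<bar> \<le> S"
  shows "cmod (integral {a..b} (\<lambda>x. cis (p x) * complex_of_real (\<psi> x)))
    \<le> 152 * S * m powr (-1/3) * T powr (-1/3)"
proof -
  have pos: "cmod (integral {a..b} (\<lambda>x. cis (q x) * complex_of_real (\<psi> x)))
      \<le> 4 * S * (38 * (T * m) powr (-1/3))"
    if q: "\<And>x. x \<in> {a..b} \<Longrightarrow> (q has_real_derivative q1 x) (at x within {a..b})"
    and q1: "\<And>x. x \<in> {a..b} \<Longrightarrow> (q1 has_real_derivative q2 x) (at x within {a..b})"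
    and q2: "\<And>x. x \<in> {a..b} \<Longrightarrow> (q2 has_real_derivative q3 x) (at x within {a..b})"
    and ge: "\<And>x. x \<in> {a..b} \<Longrightarrow> T * m \<le> q3 x"
  for q q1 q2 q3 :: "real \<Rightarrow> real"
  proof (rule monotone_amplitude_bound[OF \<open>a \<le> b\<close> _ mono \<psi>])
    have "continuous_on {a..b} q" using q by (rule DERIV_continuous_on)
    then show "continuous_on {a..b} (\<lambda>x. cis (q x))" by (intro continuous_intros)
    show "cmod (integral {c..d} (\<lambda>x. cis (q x))) \<le> 38 * (T * m) powr (-1/3)"
      if "a \<le> c" "c \<le> d" "d \<le> b" for c d
      by (rule van_der_Corput_3[where ?p1.0 = q1 and ?p2.0 = q2 and ?p3.0 = q3])
        (use that \<open>0 < T\<close> \<open>0 < m\<close> ge in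
          \<open>auto intro!: DERIV_subset[OF q] DERIV_subset[OF q1] DERIV_subset[OF q2]\<close>)
  qed
  have "cmod (integral {a..b} (\<lambda>x. cis (p x) * complex_of_real (\<psi> x)))
      \<le> 4 * S * (38 * (T * m) powr (-1/3))"
    using ge
  proof
    assume "\<forall>x\<in>{a..b}. T * m \<le> p3 x"
    then show ?thesis by (intro pos[OF p p1 p2]) auto
  next
    assume neg: "\<forall>x\<in>{a..b}. p3 x \<le> - (T * m)"
    have "T * m \<le> - p3 x" if "x \<in> {a..b}" for x
      using bspec[OF neg that] by linarith
    from pos[OF DERIV_minus[OF p] DERIV_minus[OF p1] DERIV_minus[OF p2] this]
    show ?thesis by (simp add: cmod_integral_cis_minus)
  qed
  then show ?thesis by (simp add: powr_mult mult_ac)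
qed

text \<open>
  The hypotheses on the phase hold strictly between two cut points but may fail at the cut points
  themselves, for instance at a zero of the third derivative. By continuity of the integral in its
  limits it suffices to treat compact subintervals of the interior.
\<close>

lemma integral_bound_from_interior:
  fixes F :: "real \<Rightarrow> complex"
  assumes F: "continuous_on {a..b} F" and "0 \<le> B"
    and piece: "\<And>l r. a < l \<Longrightarrow> l < r \<Longrightarrow> r < b \<Longrightarrow> cmod (integral {l..r} F) \<le> B"
  shows "cmod (integral {a..b} F) \<le> B"
proof (cases "a < b")
  case True
  have int: "F integrable_on {l..b}" if "a \<le> l" for l
    by (rule integrable_continuous_real, rule continuous_on_subset[OF F]) (use that in auto)
  have right: "cmod (integral {l..b} F) \<le> B" if "a < l" "l < b" for l
  proof (rule continuous_le_on_closure[of "{l<..<b}" "\<lambda>r. cmod (integral {l..r} F)"])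
    show "continuous_on (closure {l<..<b}) (\<lambda>r. cmod (integral {l..r} F))"
      using indefinite_integral_continuous_1[OF int[of l]] that by (auto intro: continuous_intros)
  qed (use piece that in auto)
  show ?thesis
  proof (rule continuous_le_on_closure[of "{a<..<b}" "\<lambda>l. cmod (integral {l..b} F)"])
    show "continuous_on (closure {a<..<b}) (\<lambda>l. cmod (integral {l..b} F))"
      using indefinite_integral_continuous_1'[OF int[of a]] True by (auto intro: continuous_intros)
  qed (use right True in auto)
next
  case False
  then show ?thesis using \<open>0 \<le> B\<close> by (cases "a = b") auto
qed

text \<open>
  Each cut point is removed by splitting the interval there. The remaining cut points are kept for
  both halves, which doubles the bound. The resulting dependence on \<open>card Q\<close> is exponential,
  but all that matters is that the length of the interval does not enter.
\<close>

lemma integral_bound_off_finite: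
  fixes F :: "real \<Rightarrow> complex"
  assumes "finite Q" "continuous_on {a..b} F" "0 \<le> B"
    and "\<And>l r. a < l \<Longrightarrow> l < r \<Longrightarrow> r < b \<Longrightarrow> {l..r} \<inter> Q = {} \<Longrightarrow> cmod (integral {l..r} F) \<le> B"
  shows "cmod (integral {a..b} F) \<le> 2 ^ card Q * B"
  using assms
proof (induction Q arbitrary: a b rule: finite_induct)
  case empty
  then show ?case by (auto intro: integral_bound_from_interior)
next
  case (insert q Q)
  note F = insert.prems(1) and piece = insert.prems(3)
  show ?case
  proof (cases "a < q \<and> q < b")
    case True
    have "cmod (integral {a..q} F) \<le> 2 ^ card Q * B"
      using True \<open>0 \<le> B\<close>
      by (intro insert.IH piece) (auto intro: continuous_on_subset[OF F])
    moreover have "cmod (integral {q..b} F) \<le> 2 ^ card Q * B"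
      using True \<open>0 \<le> B\<close>
      by (intro insert.IH piece) (auto intro: continuous_on_subset[OF F])
    moreover have "integral {a..b} F = integral {a..q} F + integral {q..b} F"
      using True F by (intro Henstock_Kurzweil_Integration.integral_combine[symmetric]
        integrable_continuous_real) auto
    ultimately show ?thesis
      using insert.hyps norm_triangle_ineq[of "integral {a..q} F" "integral {q..b} F"] by simp
  next
    case False
    have "cmod (integral {a..b} F) \<le> 2 ^ card Q * B"
      using F \<open>0 \<le> B\<close> False by (intro insert.IH piece) auto
    also have "\<dots> \<le> 2 ^ card (insert q Q) * B"
      using insert.hyps \<open>0 \<le> B\<close> by simp
    finally show ?thesis .
  qed
qed

lemma continuous_nonzero_sign:
  fixes f :: "real \<Rightarrow> real"
  assumes "continuous_on {a..b} f" "\<And>x. x \<in> {a..b} \<Longrightarrow> f x \<noteq> 0"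
  shows "(\<forall>x\<in>{a..b}. 0 < f x) \<or> (\<forall>x\<in>{a..b}. f x < 0)"
proof (rule ccontr)
  assume "\<not> ?thesis"
  then obtain x y where xy: "x \<in> {a..b}" "y \<in> {a..b}" "f x \<le> 0" "0 \<le> f y"
    by (auto simp: not_less)
  have "is_interval (f ` {a..b})"
    using connected_continuous_image[OF assms(1)] by (simp add: is_interval_connected_1)
  then have "0 \<in> f ` {a..b}" using xy unfolding is_interval_1 by blast
  then show False using assms(2) by auto
qed

lemma mono_abs_powr:
  fixes f :: "real \<Rightarrow> real"
  assumes mono: "mono_on A f \<or> antimono_on A f"
    and sign: "(\<forall>x\<in>A. 0 < f x) \<or> (\<forall>x\<in>A. f x < 0)" and "0 \<le> e"
  shows "mono_on A (\<lambda>x. \<bar>f x\<bar> powr e) \<or> antimono_on A (\<lambda>x. \<bar>f x\<bar> powr e)"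
proof -
  have "(\<forall>x\<in>A. \<bar>f x\<bar> = f x) \<or> (\<forall>x\<in>A. \<bar>f x\<bar> = - f x)"
    using sign by (auto simp: abs_of_pos abs_of_neg)
  then have "mono_on A (\<lambda>x. \<bar>f x\<bar>) \<or> antimono_on A (\<lambda>x. \<bar>f x\<bar>)"
    using mono by (elim disjE) (simp_all add: monotone_on_def)
  then show ?thesis
    using \<open>0 \<le> e\<close> by (auto simp: monotone_on_def intro!: powr_mono2)
qed

section \<open>The class of phases\<close>

lemma bounded_interval_endpoints:
  assumes "bounded_interval \<Omega>"
  obtains A B where "A < B" "closure \<Omega> = {A..B}" "{A<..<B} \<subseteq> \<Omega>"
proof -
  have int: "is_interval \<Omega>" and "bounded \<Omega>" and ne: "interior \<Omega> \<noteq> {}"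
    using assms by (auto simp: bounded_interval_def)
  have conv: "convex \<Omega>" using int by (simp add: is_interval_convex_1)
  have "compact (closure \<Omega>)" using \<open>bounded \<Omega>\<close> by simp
  moreover have "connected (closure \<Omega>)"
    using conv by (simp add: convex_closure convex_connected)
  ultimately obtain A B where AB: "closure \<Omega> = {A..B}"
    using connected_compact_interval_1 by blast
  have "interior \<Omega> = {A<..<B}"
    using convex_interior_closure[OF conv] AB by simp
  then show thesis
    using that[OF _ AB] ne interior_subset[of \<Omega>] by force
qed

lemma Ck_on_has_real_derivative:
  assumes "Ck_on k X f" "j < k" "x \<in> X"
  shows "(nderiv_within X j f has_real_derivative nderiv_within X (Suc j) f x) (at x within X)"
proof -
  have "nderiv_within X j f differentiable (at x within X)"
    using assms by (auto simp: Ck_on_def differentiable_on_def)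
  then show ?thesis
    by (simp add: has_real_derivative_iff_has_vector_derivative vector_derivative_works)
qed

text \<open>
  The power of 2 accounts for the cut points, at most \<open>M\<close> changes of monotonicity and three
  for each zero; the sum dominates the bound for any single interval between cut points.
\<close>

definition A3_bound :: "(real \<times> real \<times> real \<times> real) list \<Rightarrow> nat \<Rightarrow> real \<Rightarrow> real \<Rightarrow> real" where
  "A3_bound qs M m K = 2 ^ (M + 3 * length qs) *
     (152 * K powr (1/3) * m powr (-1/3) +
      (\<Sum>(\<epsilon>, c1, c2, \<alpha>)\<leftarrow>qs. near_zero_const c1 (\<alpha> - 3) (c2 powr (1/3))))"

text \<open>
  The cut points \<open>Q\<close> are the changes of monotonicity, the zeros \<open>z\<close>, and the
  ends \<open>z - \<epsilon>\<close>, \<open>z + \<epsilon>\<close> of their neighbourhoods. An interval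
  without cut points lies in one of these neighbourhoods on one side of \<open>z\<close>, or it is
  disjoint from all of them, so that either the bounds at \<open>z\<close> or the bounds \<open>m\<close>
  and \<open>K\<close> hold throughout.
\<close>

lemma osc_integral_bound:
  assumes \<Omega>: "bounded_interval \<Omega>" and "\<phi> \<in> A3 \<Omega>"
    and constants: "A3_constants qs M m K \<Omega> \<phi>" and "t \<noteq> 0"
  shows "cmod (osc_integral \<Omega> \<phi> x0 t) \<le> A3_bound qs M m K * \<bar>t\<bar> powr (-1/3)"
proof -
  obtain A B where "A < B" and cl: "closure \<Omega> = {A..B}" and inside: "{A<..<B} \<subseteq> \<Omega>"
    using bounded_interval_endpoints[OF \<Omega>] .
  define d where "d k = nderiv_within {A..B} k \<phi>" for k
  have d3: "deriv3 \<Omega> \<phi> = d 3" by (simp add: d_def cl)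
  have "Ck_on 4 {A..B} \<phi>" using \<open>\<phi> \<in> A3 \<Omega>\<close> by (simp add: A3_def cl)
  from Ck_on_has_real_derivative[OF this]
  have deriv: "(d j has_real_derivative d (Suc j) x) (at x within {A..B})"
    if "j < 4" "x \<in> {A..B}" for j x
    using that by (simp only: d_def)
  have cd3: "continuous_on {A..B} (d 3)"
    by (rule DERIV_continuous_on[OF deriv]) auto
  obtain zs P where zs: "set zs = zeros3 \<Omega> \<phi>" "list_all2 (zero_bounds \<Omega> \<phi>) zs qs"
    and "0 < m"
    and away_ball: "\<forall>x\<in>\<Omega>. (\<forall>(z, \<epsilon>, _) \<in> set (zip zs qs). \<epsilon> \<le> \<bar>x - z\<bar>) \<longrightarrow>
      m \<le> \<bar>d 3 x\<bar> \<and> \<bar>d 3 x\<bar> \<le> K"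
    and P: "monotone_off \<Omega> (d 3) P" "card P \<le> M"
    using constants unfolding A3_constants_def d3 by blast
  have away: "m \<le> \<bar>d 3 x\<bar> \<and> \<bar>d 3 x\<bar> \<le> K"
    if "x \<in> \<Omega>" "\<And>z \<epsilon> q. (z, \<epsilon>, q) \<in> set (zip zs qs) \<Longrightarrow> \<epsilon> \<le> \<bar>x - z\<bar>" for x
  proof -
    have "\<forall>(z, \<epsilon>, _) \<in> set (zip zs qs). \<epsilon> \<le> \<bar>x - z\<bar>"
      using that(2) by (auto split: prod.splits)
    with away_ball \<open>x \<in> \<Omega>\<close> show ?thesis by blast
  qed
  have "finite P" using P(1) by (simp add: monotone_off_def)
  have len: "length zs = length qs" using zs(2) by (rule list_all2_lengthD)

  define p where "p = (\<lambda>x. t * \<phi> x - x0 * x)"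
  define \<psi> where "\<psi> = (\<lambda>x. \<bar>d 3 x\<bar> powr (1/3))"
  define F where "F = (\<lambda>x. cis (p x) * complex_of_real (\<psi> x))"
  have p: "(p has_real_derivative t * d 1 x - x0) (at x within {A..B})"
    and p1: "((\<lambda>x. t * d 1 x - x0) has_real_derivative t * d 2 x) (at x within {A..B})"
    and p2: "((\<lambda>x. t * d 2 x) has_real_derivative t * d 3 x) (at x within {A..B})"
    if "x \<in> {A..B}" for x
  proof -
    have D: "(\<phi> has_real_derivative d 1 x) (at x within {A..B})"
      "(d 1 has_real_derivative d 2 x) (at x within {A..B})"
      "(d 2 has_real_derivative d 3 x) (at x within {A..B})"
      using deriv[of 0 x] deriv[of 1 x] deriv[of 2 x] that
      by (simp_all add: d_def numeral_2_eq_2 numeral_3_eq_3)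
    show "(p has_real_derivative t * d 1 x - x0) (at x within {A..B})"
      unfolding p_def by (auto intro!: derivative_eq_intros D)
    show "((\<lambda>x. t * d 1 x - x0) has_real_derivative t * d 2 x) (at x within {A..B})"
      using DERIV_diff[OF DERIV_cmult[OF D(2), of t] DERIV_const[of x0]] by simp
    show "((\<lambda>x. t * d 2 x) has_real_derivative t * d 3 x) (at x within {A..B})"
      by (auto intro!: derivative_eq_intros D)
  qed
  have c\<psi>: "continuous_on {A..B} \<psi>"
    unfolding \<psi>_def by (rule continuous_on_powr') (use cd3 in \<open>auto intro: continuous_intros\<close>)
  have "continuous_on {A..B} p" using p by (rule DERIV_continuous_on)
  then have cF: "continuous_on {A..B} F"
    unfolding F_def using c\<psi> by (intro continuous_intros)

  define H :: "real \<times> real \<times> real \<times> real \<Rightarrow> real"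
    where "H = (\<lambda>(\<epsilon>, c1, c2, \<alpha>). near_zero_const c1 (\<alpha> - 3) (c2 powr (1/3)))"
  have H_nonneg: "0 \<le> H q" for q
    by (cases q) (simp add: H_def near_zero_const_nonneg)
  have sum_nonneg: "0 \<le> sum_list (map H qs')" for qs'
    by (induction qs') (auto simp: H_nonneg)
  define G where "G = 152 * K powr (1/3) * m powr (-1/3)"
  have "0 \<le> G" by (simp add: G_def)
  define Bd where "Bd = (G + sum_list (map H qs)) * \<bar>t\<bar> powr (-1/3)"
  have "0 \<le> Bd" using \<open>0 \<le> G\<close> sum_nonneg by (simp add: Bd_def)

  define W where "W = set (zip zs qs)"
  have zs_W: "set zs = fst ` W"
    using len by (metis W_def list.set_map map_fst_zip)
  have W_bounds: "zero_bounds \<Omega> \<phi> z q" and W_qs: "q \<in> set qs" if "(z, q) \<in> W" for z q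
    using that zs(2) by (auto simp: W_def list_all2_iff dest: set_zip_rightD)
  define Q where "Q = P \<union> (fst ` W \<union> ((\<lambda>(z, q). z - fst q) ` W \<union> (\<lambda>(z, q). z + fst q) ` W))"
  have "finite W" by (simp add: W_def)
  have "card W \<le> length qs"
    unfolding W_def using card_length[of "zip zs qs"] len by simp
  then have im: "card (f ` W) \<le> length qs" for f :: "real \<times> real \<times> real \<times> real \<times> real \<Rightarrow> real"
    using card_image_le[OF \<open>finite W\<close>, of f] by linarith
  have "finite Q" using \<open>finite P\<close> \<open>finite W\<close> by (simp add: Q_def)
  have "card Q \<le> card P + (card (fst ` W) + (card ((\<lambda>(z, q). z - fst q) ` W) + card ((\<lambda>(z, q). z + fst q) ` W)))"
    unfolding Q_def by (intro order_trans[OF card_Un_le] add_left_mono order_refl)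
  also have "\<dots> \<le> M + (length qs + (length qs + length qs))"
    by (intro add_mono P(2) im)
  finally have cardQ: "card Q \<le> M + 3 * length qs" by simp

  have piece: "cmod (integral {l..r} F) \<le> Bd"
    if lr: "A < l" "l < r" "r < B" and off: "{l..r} \<inter> Q = {}" for l r
  proof -
    have "{l..r} \<subseteq> {A..B}" and "{l..r} \<subseteq> \<Omega>" using lr inside by auto
    have in\<Omega>: "x \<in> \<Omega>" if "x \<in> {l..r}" for x using that \<open>{l..r} \<subseteq> \<Omega>\<close> by blast
    have nz: "d 3 x \<noteq> 0" if "x \<in> {l..r}" for x
    proof
      assume "d 3 x = 0"
      then have "x \<in> set zs" using in\<Omega>[OF that] zs(1) by (simp add: zeros3_def d3)
      then have "x \<in> Q" unfolding zs_W Q_def by blast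
      then show False using off that by blast
    qed
    have sign: "(\<forall>x\<in>{l..r}. 0 < d 3 x) \<or> (\<forall>x\<in>{l..r}. d 3 x < 0)"
      by (rule continuous_nonzero_sign[OF continuous_on_subset[OF cd3 \<open>{l..r} \<subseteq> {A..B}\<close>] nz])
    have "is_interval {l..r} \<and> {l..r} \<subseteq> \<Omega> - P"
      using \<open>{l..r} \<subseteq> \<Omega>\<close> off by (auto simp: Q_def is_interval_cc)
    then have "mono_on {l..r} (d 3) \<or> antimono_on {l..r} (d 3)"
      using P(1) unfolding monotone_off_def by blast
    then have mono: "mono_on {l..r} \<psi> \<or> antimono_on {l..r} \<psi>"
      unfolding \<psi>_def using sign by (rule mono_abs_powr) simp
    \<comment> \<open>a lower bound for the modulus of the third derivative becomes a one-signed bound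
        for the third derivative of the phase\<close>
    have third: "(\<forall>x\<in>{l..r}. \<bar>t\<bar> * g x \<le> t * d 3 x) \<or> (\<forall>x\<in>{l..r}. t * d 3 x \<le> - (\<bar>t\<bar> * g x))"
      if g: "\<And>x. x \<in> {l..r} \<Longrightarrow> g x \<le> \<bar>d 3 x\<bar>" for g :: "real \<Rightarrow> real"
    proof -
      have le: "\<bar>t\<bar> * g x \<le> \<bar>t * d 3 x\<bar>" if "x \<in> {l..r}" for x
        unfolding abs_mult using g[OF that] by (rule mult_left_mono) simp
      have "(\<forall>x\<in>{l..r}. 0 < t * d 3 x) \<or> (\<forall>x\<in>{l..r}. t * d 3 x < 0)"
        using sign \<open>t \<noteq> 0\<close> by (cases "0 < t") (auto simp: zero_less_mult_iff mult_less_0_iff)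
      then show ?thesis
        using le by (elim disj_forward) fastforce+
    qed
    note derivs = DERIV_subset[OF p \<open>{l..r} \<subseteq> {A..B}\<close>] DERIV_subset[OF p1 \<open>{l..r} \<subseteq> {A..B}\<close>]
      DERIV_subset[OF p2 \<open>{l..r} \<subseteq> {A..B}\<close>]
    have in_AB: "x \<in> {A..B}" if "x \<in> {l..r}" for x using that \<open>{l..r} \<subseteq> {A..B}\<close> by blast
    show ?thesis
    proof (cases "\<exists>z \<epsilon> q. (z, \<epsilon>, q) \<in> W \<and> \<bar>l - z\<bar> < \<epsilon>")
      case True
      then obtain z \<epsilon> c1 c2 \<alpha> where W: "(z, \<epsilon>, c1, c2, \<alpha>) \<in> W" and near: "\<bar>l - z\<bar> < \<epsilon>" by auto
      have zb: "zero_bounds \<Omega> \<phi> z (\<epsilon>, c1, c2, \<alpha>)" by (rule W_bounds[OF W])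
      then have "0 < c1" "0 < c2" "3 \<le> \<alpha>" by auto
      have "z \<in> Q" "z - \<epsilon> \<in> Q" "z + \<epsilon> \<in> Q"
        using W unfolding Q_def by (force simp: image_iff)+
      then have nin: "z \<notin> {l..r}" "z - \<epsilon> \<notin> {l..r}" "z + \<epsilon> \<notin> {l..r}" using off by auto
      then have side: "z < l \<or> r < z" using lr by auto
      have close: "\<bar>x - z\<bar> < \<epsilon>" if "x \<in> {l..r}" for x
        using that near nin side by auto
      have lower: "c1 * \<bar>x - z\<bar> powr (\<alpha> - 3) \<le> \<bar>d 3 x\<bar>"
        and upper: "\<bar>d 3 x\<bar> \<le> c2 * \<bar>x - z\<bar> powr (\<alpha> - 3)" if "x \<in> {l..r}" for x
        using zb in\<Omega>[OF that] close[OF that] by (auto simp: d3)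
      have "cmod (integral {l..r} (\<lambda>x. cis (p x) * complex_of_real (\<psi> x)))
          \<le> near_zero_const c1 (\<alpha> - 3) (c2 powr (1/3)) * \<bar>t\<bar> powr (-1/3)"
      proof (rule one_sided_zero_bound[OF side, where ?p1.0 = "\<lambda>x. t * d 1 x - x0"
            and ?p2.0 = "\<lambda>x. t * d 2 x" and ?p3.0 = "\<lambda>x. t * d 3 x"])
        show "(\<forall>x\<in>{l..r}. \<bar>t\<bar> * c1 * \<bar>x - z\<bar> powr (\<alpha> - 3) \<le> t * d 3 x) \<or>
             (\<forall>x\<in>{l..r}. t * d 3 x \<le> - (\<bar>t\<bar> * c1 * \<bar>x - z\<bar> powr (\<alpha> - 3)))"
          using third[OF lower] by (simp add: mult.assoc)
        show "\<bar>\<psi> x\<bar> \<le> c2 powr (1/3) * \<bar>x - z\<bar> powr ((\<alpha> - 3)/3)" if "x \<in> {l..r}" for x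
        proof -
          have "\<bar>\<psi> x\<bar> \<le> (c2 * \<bar>x - z\<bar> powr (\<alpha> - 3)) powr (1/3)"
            unfolding \<psi>_def using upper[OF that] by (simp add: powr_mono2)
          then show ?thesis by (simp add: powr_mult powr_powr)
        qed
        show "continuous_on {l..r} \<psi>" by (rule continuous_on_subset[OF c\<psi> \<open>{l..r} \<subseteq> {A..B}\<close>])
      qed (use lr \<open>t \<noteq> 0\<close> \<open>0 < c1\<close> \<open>3 \<le> \<alpha>\<close> mono derivs in_AB in auto)
      also have "\<dots> = H (\<epsilon>, c1, c2, \<alpha>) * \<bar>t\<bar> powr (-1/3)" by (simp add: H_def)
      also have "\<dots> \<le> Bd"
        unfolding Bd_def
      proof (rule mult_right_mono)
        show "H (\<epsilon>, c1, c2, \<alpha>) \<le> G + sum_list (map H qs)"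
          using sum_list_map_remove1[OF W_qs[OF W], of H] \<open>0 \<le> G\<close>
            sum_nonneg[of "remove1 (\<epsilon>, c1, c2, \<alpha>) qs"] by linarith
      qed simp
      finally show ?thesis by (simp add: F_def)
    next
      case False
      have far: "\<epsilon> \<le> \<bar>x - z\<bar>" if "(z, \<epsilon>, q) \<in> W" "x \<in> {l..r}" for z \<epsilon> q x
      proof (rule ccontr)
        assume "\<not> \<epsilon> \<le> \<bar>x - z\<bar>"
        moreover have "z - \<epsilon> \<notin> {l..r}" "z + \<epsilon> \<notin> {l..r}"
          using that(1) off unfolding Q_def by (force simp: image_iff)+
        moreover have "\<not> \<bar>l - z\<bar> < \<epsilon>" using False that(1) by blast
        ultimately show False using that(2) by auto
      qed
      have bounds: "m \<le> \<bar>d 3 x\<bar>" "\<bar>d 3 x\<bar> \<le> K" if "x \<in> {l..r}" for x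
        using away[OF in\<Omega>[OF that]] far that by (auto simp: W_def)
      have "cmod (integral {l..r} (\<lambda>x. cis (p x) * complex_of_real (\<psi> x)))
          \<le> 152 * K powr (1/3) * m powr (-1/3) * \<bar>t\<bar> powr (-1/3)"
      proof (rule away_from_zeros_bound[where ?p1.0 = "\<lambda>x. t * d 1 x - x0"
            and ?p2.0 = "\<lambda>x. t * d 2 x" and ?p3.0 = "\<lambda>x. t * d 3 x"])
        show "(\<forall>x\<in>{l..r}. \<bar>t\<bar> * m \<le> t * d 3 x) \<or> (\<forall>x\<in>{l..r}. t * d 3 x \<le> - (\<bar>t\<bar> * m))"
          by (rule third[OF bounds(1)])
        show "\<bar>\<psi> x\<bar> \<le> K powr (1/3)" if "x \<in> {l..r}" for x
          unfolding \<psi>_def using bounds(2)[OF that] by (simp add: powr_mono2)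
      qed (use lr \<open>t \<noteq> 0\<close> \<open>0 < m\<close> mono derivs in_AB in auto)
      also have "\<dots> \<le> Bd"
        unfolding Bd_def G_def[symmetric]
        by (rule mult_right_mono) (use sum_nonneg[of qs] in auto)
      finally show ?thesis by (simp add: F_def)
    qed
  qed
  have "negligible (frontier \<Omega>)"
    using \<Omega> by (intro negligible_convex_frontier) (simp add: bounded_interval_def is_interval_convex_1)
  moreover have "(F has_integral integral {A..B} F) (closure \<Omega>)"
    unfolding cl using cF by (intro integrable_integral integrable_continuous_real)
  ultimately have "(F has_integral integral {A..B} F) \<Omega>"
    by (simp add: has_integral_closure)
  then have "integral {A..B} F = integral \<Omega> F"
    by (simp add: integral_unique)
  moreover have "osc_integral \<Omega> \<phi> x0 t = integral \<Omega> F"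
    by (simp add: osc_integral_def F_def p_def \<psi>_def d3 cis_conv_exp)
  ultimately have "cmod (osc_integral \<Omega> \<phi> x0 t) = cmod (integral {A..B} F)" by simp
  also have "\<dots> \<le> 2 ^ card Q * Bd"
    by (rule integral_bound_off_finite[OF \<open>finite Q\<close> cF \<open>0 \<le> Bd\<close> piece])
  also have "\<dots> \<le> 2 ^ (M + 3 * length qs) * Bd"
    using cardQ \<open>0 \<le> Bd\<close> by (intro mult_right_mono power_increasing) auto
  also have "\<dots> = A3_bound qs M m K * \<bar>t\<bar> powr (-1/3)"
    by (simp add: A3_bound_def Bd_def G_def H_def o_def)
  finally show ?thesis .
qed

text \<open>
  Off the open \<open>\<epsilon>\<close>-neighbourhoods of the zeros the closure of \<open>\<Omega>\<close>
  is a compact set on which the third derivative is continuous and, since its zeros in the closure all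
  lie in \<open>\<Omega>\<close>, nonzero. Hence its modulus has a positive minimum and a maximum there.
\<close>

lemma A3_constants_exist:
  assumes \<Omega>: "bounded_interval \<Omega>" and \<phi>: "\<phi> \<in> A3 \<Omega>"
    and zeros: "\<And>\<xi>. \<xi> \<in> closure \<Omega> \<Longrightarrow> deriv3 \<Omega> \<phi> \<xi> = 0 \<Longrightarrow> \<xi> \<in> \<Omega>"
  shows "\<exists>qs M m K. A3_constants qs M m K \<Omega> \<phi>"
proof -
  define d3 where "d3 = deriv3 \<Omega> \<phi>"
  have "compact (closure \<Omega>)" using \<Omega> by (simp add: bounded_interval_def)
  have cont: "continuous_on (closure \<Omega>) d3"
    unfolding d3_def
    by (rule DERIV_continuous_on[OF Ck_on_has_real_derivative[of 4]]) (use \<phi> in \<open>auto simp: A3_def\<close>)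
  obtain zs where "distinct zs" and zs: "set zs = zeros3 \<Omega> \<phi>"
    using \<phi> finite_distinct_list[of "zeros3 \<Omega> \<phi>"] by (auto simp: A3_def)
  have "\<forall>z\<in>zeros3 \<Omega> \<phi>. \<exists>q. zero_bounds \<Omega> \<phi> z q"
    using \<phi> unfolding A3_def by blast
  then obtain q where q: "\<And>z. z \<in> zeros3 \<Omega> \<phi> \<Longrightarrow> zero_bounds \<Omega> \<phi> z (q z)" by metis
  obtain P where P: "monotone_off \<Omega> (deriv3 \<Omega> \<phi>) P" using \<phi> by (auto simp: A3_def)
  define X where "X = closure \<Omega> \<inter> (\<Inter>z\<in>set zs. {x. fst (q z) \<le> \<bar>x - z\<bar>})"
  have "compact X"
    unfolding X_def
    by (intro compact_Int_closed \<open>compact (closure \<Omega>)\<close> closed_INT ballI closed_Collect_le continuous_intros)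
  have cX: "continuous_on X (\<lambda>x. \<bar>d3 x\<bar>)"
    by (intro continuous_intros continuous_on_subset[OF cont]) (auto simp: X_def)
  have pos: "0 < \<bar>d3 x\<bar>" if "x \<in> X" for x
  proof (rule ccontr)
    assume "\<not> 0 < \<bar>d3 x\<bar>"
    then have "d3 x = 0" by simp
    then have "x \<in> zeros3 \<Omega> \<phi>" using zeros[of x] that by (auto simp: X_def zeros3_def d3_def)
    then have "fst (q x) \<le> \<bar>x - x\<bar>" "0 < fst (q x)"
      using that zs q[of x] by (auto simp: X_def simp del: abs_zero split: prod.splits elim: zero_bounds.elims)
    then show False by simp
  qed
  obtain m K where "0 < m" and mK: "\<And>x. x \<in> X \<Longrightarrow> m \<le> \<bar>d3 x\<bar> \<and> \<bar>d3 x\<bar> \<le> K"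
  proof (cases "X = {}")
    case True
    then show thesis using that[of 1 0] by simp
  next
    case False
    obtain u where "u \<in> X" "\<And>x. x \<in> X \<Longrightarrow> \<bar>d3 u\<bar> \<le> \<bar>d3 x\<bar>"
      using continuous_attains_inf[OF \<open>compact X\<close> False cX] by blast
    moreover obtain v where "v \<in> X" "\<And>x. x \<in> X \<Longrightarrow> \<bar>d3 x\<bar> \<le> \<bar>d3 v\<bar>"
      using continuous_attains_sup[OF \<open>compact X\<close> False cX] by blast
    ultimately show thesis using that[of "\<bar>d3 u\<bar>" "\<bar>d3 v\<bar>"] pos by blast
  qed
  have "A3_constants (map q zs) (card P) m K \<Omega> \<phi>"
    unfolding A3_constants_def
  proof (intro conjI exI[of _ zs] exI[of _ P] ballI impI)
    show "list_all2 (zero_bounds \<Omega> \<phi>) zs (map q zs)"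
      using q zs by (simp add: list_all2_map2 list_all2_same)
    fix x assume "x \<in> \<Omega>" and far: "\<forall>(z, \<epsilon>, _)\<in>set (zip zs (map q zs)). \<epsilon> \<le> \<bar>x - z\<bar>"
    have "fst (q z) \<le> \<bar>x - z\<bar>" if "z \<in> set zs" for z
    proof -
      have "(z, q z) \<in> set (zip zs (map q zs))"
        using that by (simp add: zip_map2 zip_same_conv_map)
      with far show ?thesis by (cases "q z") fastforce
    qed
    then have "x \<in> X" using \<open>x \<in> \<Omega>\<close> closure_subset by (auto simp: X_def)
    then show "m \<le> \<bar>deriv3 \<Omega> \<phi> x\<bar>" "\<bar>deriv3 \<Omega> \<phi> x\<bar> \<le> K"
      using mK by (auto simp: d3_def)
  qed (use \<open>distinct zs\<close> zs \<open>0 < m\<close> P in auto)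
  then show ?thesis by blast
qed

theorem lemma3p3:
  shows "\<exists>C :: (real \<times> real \<times> real \<times> real) list \<Rightarrow> nat \<Rightarrow> real \<Rightarrow> real \<Rightarrow> real.
    \<forall>\<Omega> \<phi>.
      bounded_interval \<Omega> \<and> \<phi> \<in> A3 \<Omega> \<and>
      (\<forall>\<xi>\<in>closure \<Omega>. deriv3 \<Omega> \<phi> \<xi> = 0 \<longrightarrow> \<xi> \<in> \<Omega>) \<longrightarrow>
      (\<exists>qs M m K. A3_constants qs M m K \<Omega> \<phi>) \<and>
      (\<forall>qs M m K. A3_constants qs M m K \<Omega> \<phi> \<longrightarrow>
         (\<forall>x t. t \<noteq> 0 \<longrightarrow>
            cmod (osc_integral \<Omega> \<phi> x t) \<le> C qs M m K * \<bar>t\<bar> powr (-1/3)))"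
proof (intro exI[of _ A3_bound] allI impI)
  fix \<Omega> :: "real set" and \<phi> :: "real \<Rightarrow> real"
  assume *: "bounded_interval \<Omega> \<and> \<phi> \<in> A3 \<Omega> \<and>
      (\<forall>\<xi>\<in>closure \<Omega>. deriv3 \<Omega> \<phi> \<xi> = 0 \<longrightarrow> \<xi> \<in> \<Omega>)"
  show "(\<exists>qs M m K. A3_constants qs M m K \<Omega> \<phi>) \<and>
      (\<forall>qs M m K. A3_constants qs M m K \<Omega> \<phi> \<longrightarrow>
         (\<forall>x t. t \<noteq> 0 \<longrightarrow>
            cmod (osc_integral \<Omega> \<phi> x t) \<le> A3_bound qs M m K * \<bar>t\<bar> powr (-1/3)))"
    using * A3_constants_exist[of \<Omega> \<phi>] osc_integral_bound[of \<Omega> \<phi>] by blast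
qed

end
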